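(* Let $\Delta\colon C^*_{red}(S)\to C^*_{red}(S)\otimes C^*_{red}(S)$ be the continuous extension to $C^*_{red}(S)$ of the map defined on $P(S)$ by $\Delta\left(\sum_{i=1}^n\lambda_iV_i\right)=\sum_{i=1}^n\lambda_i\,V_i\otimes V_i$ ($\lambda_i\in\mathbb{C}$, $V_i$ monomials). Then the pair $(C^*_{red}(S),\Delta)$ is a compact quantum semigroup.
   Context: $\Gamma$ is a discrete torsion-free abelian group written additively, and $S\subseteq\Gamma$ is a subsemigroup with $0\in S$ and $\Gamma=\{a-b : a,b\in S\}$. $\{e_a\}_{a\in S}$ is the canonical orthonormal basis of $\ell^2(S)$, and $T_a$ ($a\in S$) is the isometry $T_ae_b=e_{a+b}$. $C^*_{red}(S)\subseteq B(\ell^2(S))$ is the $C^*$-algebra generated by all $T_a,T_a^*$, $a\in S$. A monomial is a finite product of operators of the form $T_a$ and $T_b^*$ ($a,b\in S$); $P(S)$ is the algebra of finite linear combinations of monomials. $\otimes$ is the minimal $C^*$-tensor product (here realized on $\ell^2(S)\otimes\ell^2(S)$). Compact quantum semigroup: a pair $(\mathcal{A},\Delta)$ where $\mathcal{A}$ is a unital $C^*$-algebra and $\Delta\colon\mathcal{A}\to\mathcal{A}\otimes\mathcal{A}$ is a unital $*$-homomorphism that is an embedding (injective) and for which the product $(\xi\times\eta)(A)=(\xi\otimes\eta)(\Delta(A))$ makes the dual space $\mathcal{A}^*$ an associative Banach algebra (equivalently, $\Delta$ is coassociative: $(\Delta\otimes\mathrm{id})\Delta=(\mathrm{id}\otimes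\Delta)\Delta$).
   Formalization: It is a hypothesis here that the formula for Δ is well defined on P(S) and extends continuously to C*_red(S); this fails for some S, e.g. S={0,2,3,4,...} in Z, where T3*T2T2*T3 = T2T2*+T3T3*-T2T2*T3T3* but the sums of V⊗V differ. *)

theory Defs
  imports "HOL-Analysis.Analysis"
begin

section \<open>The Hilbert space of square-summable families\<close>

typedef 'a ell2 = "{x :: 'a \<Rightarrow> complex. (\<lambda>i. (cmod (x i))\<^sup>2) summable_on UNIV}"
  morphisms coord Abs_ell2
  by (rule exI[of _ "\<lambda>_. 0"]) simp

lemma coord_square_summable: "(\<lambda>i. (cmod (coord x i))\<^sup>2) summable_on UNIV"
  using coord[of x] by simp

lemma coord_Abs_ell2: "(\<lambda>i. (cmod (x i))\<^sup>2) summable_on UNIV \<Longrightarrow> coord (Abs_ell2 x) = x"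
  by (simp add: Abs_ell2_inverse)

lemma ell2_eqI: "(\<And>i. coord x i = coord y i) \<Longrightarrow> x = y"
  by (simp add: coord_inject[symmetric] ext)

lemma square_summable_add:
  assumes "(\<lambda>i. (cmod (x i))\<^sup>2) summable_on UNIV" "(\<lambda>i. (cmod (y i))\<^sup>2) summable_on UNIV"
  shows "(\<lambda>i. (cmod (x i + y i))\<^sup>2) summable_on UNIV"
proof (rule summable_on_comparison_test)
  show "(\<lambda>i. 2 * (cmod (x i))\<^sup>2 + 2 * (cmod (y i))\<^sup>2) summable_on UNIV"
    using assms by (intro summable_on_add summable_on_cmult_right)
  fix i
  have "(cmod (x i + y i))\<^sup>2 \<le> (cmod (x i) + cmod (y i))\<^sup>2"
    by (simp add: norm_triangle_ineq power_mono)
  also have "\<dots> \<le> 2 * (cmod (x i))\<^sup>2 + 2 * (cmod (y i))\<^sup>2"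
    using zero_le_power2[of "cmod (x i) - cmod (y i)"] by (simp add: power2_eq_square algebra_simps)
  finally show "(cmod (x i + y i))\<^sup>2 \<le> 2 * (cmod (x i))\<^sup>2 + 2 * (cmod (y i))\<^sup>2" .
qed simp

lemma square_summable_scale:
  assumes "(\<lambda>i. (cmod (x i))\<^sup>2) summable_on UNIV"
  shows "(\<lambda>i. (cmod (c * x i))\<^sup>2) summable_on UNIV"
  using summable_on_cmult_right[OF assms, of "(cmod c)\<^sup>2"] by (simp add: norm_mult power_mult_distrib)

lemma coord_prod_abs_summable:
  "(\<lambda>i. cmod (cnj (coord x i) * coord y i)) summable_on UNIV"
proof (rule summable_on_comparison_test)
  show "(\<lambda>i. (cmod (coord x i))\<^sup>2 + (cmod (coord y i))\<^sup>2) summable_on UNIV"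
    by (intro summable_on_add coord_square_summable)
  fix i
  have "2 * (cmod (coord x i) * cmod (coord y i)) \<le> (cmod (coord x i))\<^sup>2 + (cmod (coord y i))\<^sup>2"
    using zero_le_power2[of "cmod (coord x i) - cmod (coord y i)"]
    by (simp add: power2_eq_square algebra_simps)
  moreover have "0 \<le> cmod (coord x i) * cmod (coord y i)" by simp
  ultimately show "cmod (cnj (coord x i) * coord y i) \<le> (cmod (coord x i))\<^sup>2 + (cmod (coord y i))\<^sup>2"
    by (simp only: norm_mult complex_mod_cnj)
qed simp

lemma coord_prod_summable: "(\<lambda>i. cnj (coord x i) * coord y i) summable_on UNIV"
  by (rule abs_summable_summable[OF coord_prod_abs_summable])

definition cinner :: "'a ell2 \<Rightarrow> 'a ell2 \<Rightarrow> complex" where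
  "cinner x y = (\<Sum>\<^sub>\<infinity>i. cnj (coord x i) * coord y i)"

definition scaleC :: "complex \<Rightarrow> 'a ell2 \<Rightarrow> 'a ell2" (infixr "*\<^sub>C" 75) where
  "c *\<^sub>C x = Abs_ell2 (\<lambda>i. c * coord x i)"

lemma coord_scaleC [simp]: "coord (c *\<^sub>C x) = (\<lambda>i. c * coord x i)"
  unfolding scaleC_def by (intro coord_Abs_ell2 square_summable_scale coord_square_summable)

instantiation ell2 :: (type) real_vector
begin

definition "0 = Abs_ell2 (\<lambda>_. 0)"
definition "x + y = Abs_ell2 (\<lambda>i. coord x i + coord y i)"
definition "- x = (- 1) *\<^sub>C (x :: 'a ell2)"
definition "x - y = x + - (y :: 'a ell2)"
definition "r *\<^sub>R x = complex_of_real r *\<^sub>C (x :: 'a ell2)"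

lemma coord_zero [simp]: "coord (0 :: 'a ell2) = (\<lambda>_. 0)"
  unfolding zero_ell2_def by (rule coord_Abs_ell2) simp

lemma coord_add [simp]: "coord (x + y :: 'a ell2) = (\<lambda>i. coord x i + coord y i)"
  unfolding plus_ell2_def by (intro coord_Abs_ell2 square_summable_add coord_square_summable)

lemma coord_uminus [simp]: "coord (- x :: 'a ell2) = (\<lambda>i. - coord x i)"
  by (simp add: uminus_ell2_def)

lemma coord_minus [simp]: "coord (x - y :: 'a ell2) = (\<lambda>i. coord x i - coord y i)"
  by (simp add: minus_ell2_def)

lemma coord_scaleR [simp]: "coord (r *\<^sub>R x :: 'a ell2) = (\<lambda>i. complex_of_real r * coord x i)"
  by (simp add: scaleR_ell2_def)

instance
  by standard (auto intro!: ell2_eqI simp: algebra_simps)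

end

lemma cinner_add_left: "cinner (x + y) z = cinner x z + cinner y z"
  by (simp add: cinner_def distrib_right infsum_add coord_prod_summable)

lemma cinner_add_right: "cinner x (y + z) = cinner x y + cinner x z"
  by (simp add: cinner_def distrib_left infsum_add coord_prod_summable)

lemma cinner_scaleC_left: "cinner (c *\<^sub>C x) y = cnj c * cinner x y"
  by (simp add: cinner_def mult.assoc infsum_cmult_right')

lemma cinner_scaleC_right: "cinner x (c *\<^sub>C y) = c * cinner x y"
  by (simp add: cinner_def mult.left_commute infsum_cmult_right')

lemma cinner_commute: "cinner y x = cnj (cinner x y)"
  by (simp add: cinner_def infsum_cnj[symmetric] mult.commute)

lemma cinner_self: "cinner x x = complex_of_real (\<Sum>\<^sub>\<infinity>i. (cmod (coord x i))\<^sup>2)"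
proof -
  have "cnj z * z = complex_of_real ((cmod z)\<^sup>2)" for z
    by (metis complex_norm_square mult.commute of_real_power)
  then show ?thesis
    using infsumI[OF has_sum_of_real[OF has_sum_infsum[OF coord_square_summable[of x]]]]
    by (simp add: cinner_def del: of_real_power)
qed

instantiation ell2 :: (type) real_inner
begin

definition "inner x y = Re (cinner x (y :: 'a ell2))"
definition "norm (x :: 'a ell2) = sqrt (inner x x)"
definition "dist x y = norm (x - y :: 'a ell2)"
definition "sgn x = x /\<^sub>R norm (x :: 'a ell2)"
definition [code del]:
  "(uniformity :: ('a ell2 \<times> 'a ell2) filter) = (INF e\<in>{0<..}. principal {(x, y). dist x y < e})"
definition [code del]:
  "open (U :: 'a ell2 set) = (\<forall>x\<in>U. eventually (\<lambda>(x', y). x' = x \<longrightarrow> y \<in> U) uniformity)"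

instance
proof
  fix x y z :: "'a ell2" and r :: real
  show "inner x y = inner y x"
    by (simp add: inner_ell2_def cinner_commute[of y x])
  show "inner (x + y) z = inner x z + inner y z"
    by (simp add: inner_ell2_def cinner_add_left)
  show "inner (r *\<^sub>R x) y = r * inner x y"
    by (simp add: inner_ell2_def scaleR_ell2_def cinner_scaleC_left)
  show "0 \<le> inner x x"
    by (simp add: inner_ell2_def cinner_self infsum_nonneg)
  show "inner x x = 0 \<longleftrightarrow> x = 0"
  proof
    assume "inner x x = 0"
    then have *: "(\<Sum>\<^sub>\<infinity>i. (cmod (coord x i))\<^sup>2) \<le> 0"
      by (simp add: inner_ell2_def cinner_self)
    have "(cmod (coord x i))\<^sup>2 = 0" for i
      by (rule nonneg_infsum_le_0D[OF * coord_square_summable]) auto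
    then show "x = 0" by (intro ell2_eqI) simp
  qed (simp add: inner_ell2_def cinner_def)
qed (simp_all add: norm_ell2_def dist_ell2_def sgn_ell2_def uniformity_ell2_def open_ell2_def)

end

lemma norm_ell2_square: "(norm (x :: 'a ell2))\<^sup>2 = (\<Sum>\<^sub>\<infinity>i. (cmod (coord x i))\<^sup>2)"
  by (simp add: power2_norm_eq_inner inner_ell2_def cinner_self)

lemma norm_scaleC: "norm (c *\<^sub>C x) = cmod c * norm x"
proof -
  have "(norm (c *\<^sub>C x))\<^sup>2 = (cmod c * norm x)\<^sup>2"
    by (simp add: norm_ell2_square norm_mult power_mult_distrib infsum_cmult_right')
  then show ?thesis by simp
qed

lemma sum_square_le_norm:
  assumes "finite F"
  shows "(\<Sum>i\<in>F. (cmod (coord x i))\<^sup>2) \<le> (norm x)\<^sup>2"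
  unfolding norm_ell2_square using assms
  by (intro finite_sum_le_infsum coord_square_summable) auto

lemma cmod_coord_le_norm: "cmod (coord x i) \<le> norm x"
  using sum_square_le_norm[of "{i}" x] by (simp add: power2_le_iff_abs_le)

instance ell2 :: (type) banach
proof
  fix X :: "nat \<Rightarrow> 'a ell2"
  assume X: "Cauchy X"
  have "Cauchy (\<lambda>n. coord (X n) i)" for i
  proof (rule metric_CauchyI)
    fix e :: real assume "0 < e"
    then obtain N where N: "\<forall>m\<ge>N. \<forall>n\<ge>N. norm (X m - X n) < e"
      using CauchyD[OF X] by blast
    have le: "dist (coord (X m) i) (coord (X n) i) \<le> norm (X m - X n)" for m n
      using cmod_coord_le_norm[of "X m - X n" i] by (simp add: dist_norm)
    have "dist (coord (X m) i) (coord (X n) i) < e" if "m \<ge> N" "n \<ge> N" for m n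
      using le[of m n] N[rule_format, OF that] by linarith
    then show "\<exists>N. \<forall>m\<ge>N. \<forall>n\<ge>N. dist (coord (X m) i) (coord (X n) i) < e" by blast
  qed
  then have "\<exists>l. (\<lambda>n. coord (X n) i) \<longlonglongrightarrow> l" for i
    by (simp add: Cauchy_convergent_iff convergent_def)
  then obtain f where f: "\<And>i. (\<lambda>n. coord (X n) i) \<longlonglongrightarrow> f i" by metis
  have bound: "(\<Sum>i\<in>F. (cmod (f i - coord (X n) i))\<^sup>2) \<le> e\<^sup>2"
    if "finite F" and N: "\<forall>m\<ge>N. \<forall>n\<ge>N. norm (X m - X n) < e" and "n \<ge> N" for F e N n
  proof (rule LIMSEQ_le_const2)
    show "(\<lambda>m. \<Sum>i\<in>F. (cmod (coord (X m) i - coord (X n) i))\<^sup>2)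
        \<longlonglongrightarrow> (\<Sum>i\<in>F. (cmod (f i - coord (X n) i))\<^sup>2)"
      by (intro tendsto_intros f)
    have "(\<Sum>i\<in>F. (cmod (coord (X m) i - coord (X n) i))\<^sup>2) \<le> e\<^sup>2" if "m \<ge> N" for m
    proof -
      have "(\<Sum>i\<in>F. (cmod (coord (X m) i - coord (X n) i))\<^sup>2) \<le> (norm (X m - X n))\<^sup>2"
        using sum_square_le_norm[OF \<open>finite F\<close>, of "X m - X n"] by simp
      also have "\<dots> \<le> e\<^sup>2"
        using N that \<open>n \<ge> N\<close> by (intro power_mono) (auto intro: less_imp_le)
      finally show ?thesis .
    qed
    then show "\<exists>M. \<forall>m\<ge>M. (\<Sum>i\<in>F. (cmod (coord (X m) i - coord (X n) i))\<^sup>2) \<le> e\<^sup>2" by blast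
  qed
  have diff: "(\<lambda>i. (cmod (f i - coord (X n) i))\<^sup>2) summable_on UNIV"
    if "\<forall>m\<ge>N. \<forall>n\<ge>N. norm (X m - X n) < e" "n \<ge> N" for e N n
  proof (rule nonneg_bdd_above_summable_on)
    show "bdd_above (sum (\<lambda>i. (cmod (f i - coord (X n) i))\<^sup>2) ` {F. F \<subseteq> UNIV \<and> finite F})"
      using bound[OF _ that] by (auto intro!: bdd_aboveI[of _ "e\<^sup>2"])
  qed simp
  obtain N1 where N1: "\<forall>m\<ge>N1. \<forall>n\<ge>N1. norm (X m - X n) < 1"
    using CauchyD[OF X zero_less_one] by blast
  have f_coord: "coord (Abs_ell2 f) = f"
  proof (rule coord_Abs_ell2)
    have "(\<lambda>i. (cmod ((f i - coord (X N1) i) + coord (X N1) i))\<^sup>2) summable_on UNIV"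
      by (intro square_summable_add coord_square_summable diff[OF N1]) simp
    then show "(\<lambda>i. (cmod (f i))\<^sup>2) summable_on UNIV" by simp
  qed
  have "X \<longlonglongrightarrow> Abs_ell2 f"
  proof (rule metric_LIMSEQ_I)
    fix r :: real assume "0 < r"
    then obtain N where N: "\<forall>m\<ge>N. \<forall>n\<ge>N. norm (X m - X n) < r / 2"
      using CauchyD[OF X half_gt_zero] by blast
    have le: "norm (Abs_ell2 f - X n) \<le> r / 2" if "n \<ge> N" for n
    proof (rule power2_le_imp_le)
      have "(norm (Abs_ell2 f - X n))\<^sup>2 = (\<Sum>\<^sub>\<infinity>i. (cmod (f i - coord (X n) i))\<^sup>2)"
        by (simp add: norm_ell2_square f_coord)
      also have "\<dots> \<le> (r / 2)\<^sup>2"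
        by (rule infsum_le_finite_sums[OF diff[OF N that]]) (rule bound[OF _ N that])
      finally show "(norm (Abs_ell2 f - X n))\<^sup>2 \<le> (r / 2)\<^sup>2" .
    qed (use \<open>0 < r\<close> in simp)
    have "dist (X n) (Abs_ell2 f) < r" if "n \<ge> N" for n
      using le[OF that] \<open>0 < r\<close>
      by (simp add: dist_norm norm_minus_commute)
    then show "\<exists>N. \<forall>n\<ge>N. dist (X n) (Abs_ell2 f) < r" by blast
  qed
  then show "convergent X" by (auto simp: convergent_def)
qed

definition ket :: "'a \<Rightarrow> 'a ell2" where
  "ket a = Abs_ell2 (\<lambda>i. if i = a then 1 else 0)"

lemma coord_ket [simp]: "coord (ket a) = (\<lambda>i. if i = a then 1 else 0)"
  unfolding ket_def
proof (rule coord_Abs_ell2)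
  show "(\<lambda>i. (cmod (if i = a then 1 else 0))\<^sup>2) summable_on UNIV"
    by (rule finite_nonzero_values_imp_summable_on) (auto intro: finite_subset[of _ "{a}"])
qed

text \<open>\<open>\<ell>\<^sup>2(I) \<otimes> \<ell>\<^sup>2(J)\<close> is realised as \<open>\<ell>\<^sup>2(I \<times> J)\<close>.\<close>

definition vec_tensor :: "'a ell2 \<Rightarrow> 'b ell2 \<Rightarrow> ('a \<times> 'b) ell2" where
  "vec_tensor x y = Abs_ell2 (\<lambda>(i, j). coord x i * coord y j)"

lemma coord_vec_tensor [simp]: "coord (vec_tensor x y) = (\<lambda>(i, j). coord x i * coord y j)"
  unfolding vec_tensor_def
proof (rule coord_Abs_ell2)
  have "(\<lambda>(i, j). (cmod (coord x i))\<^sup>2 * (cmod (coord y j))\<^sup>2) summable_on UNIV \<times> UNIV"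
  proof (rule summable_on_SigmaI)
    show "((\<lambda>j. (\<lambda>(i, j). (cmod (coord x i))\<^sup>2 * (cmod (coord y j))\<^sup>2) (i, j))
        has_sum ((cmod (coord x i))\<^sup>2 * (norm y)\<^sup>2)) UNIV" for i
      unfolding norm_ell2_square
      by (auto intro!: has_sum_cmult_right has_sum_infsum coord_square_summable)
    show "(\<lambda>i. (cmod (coord x i))\<^sup>2 * (norm y)\<^sup>2) summable_on UNIV"
      by (intro summable_on_cmult_left coord_square_summable)
  qed auto
  then show "(\<lambda>p. (cmod (case p of (i, j) \<Rightarrow> coord x i * coord y j))\<^sup>2) summable_on UNIV"
    by (simp add: case_prod_unfold norm_mult power_mult_distrib)
qed


section \<open>Operators\<close>

definition clinear_op :: "('a ell2 \<Rightarrow>\<^sub>L 'b ell2) \<Rightarrow> bool" where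
  "clinear_op A \<longleftrightarrow> (\<forall>c x. A (c *\<^sub>C x) = c *\<^sub>C A x)"

definition scale_op :: "complex \<Rightarrow> ('a ell2 \<Rightarrow>\<^sub>L 'b ell2) \<Rightarrow> ('a ell2 \<Rightarrow>\<^sub>L 'b ell2)"
    (infixr "*\<^sub>O" 75) where
  "c *\<^sub>O A = Blinfun (\<lambda>x. c *\<^sub>C A x)"

lemma scale_op_apply [simp]: "(c *\<^sub>O A) x = c *\<^sub>C A x"
  unfolding scale_op_def
proof (rule bounded_linear_Blinfun_apply[THEN fun_cong], rule bounded_linear_intro)
  show "norm (c *\<^sub>C A x) \<le> norm x * (cmod c * norm A)" for x
    using mult_left_mono[OF norm_blinfun[of A x], of "cmod c"]
    by (simp add: norm_scaleC mult.left_commute mult.commute[of "norm x"])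
qed (simp_all add: ell2_eqI blinfun.add_right blinfun.scaleR_right distrib_left mult.left_commute)

definition adj :: "('a ell2 \<Rightarrow>\<^sub>L 'b ell2) \<Rightarrow> ('b ell2 \<Rightarrow>\<^sub>L 'a ell2)" where
  "adj A = (THE B :: 'b ell2 \<Rightarrow>\<^sub>L 'a ell2. \<forall>x y. cinner (A x) y = cinner x (B y))"

definition op_tensor :: "('a ell2 \<Rightarrow>\<^sub>L 'a ell2) \<Rightarrow> ('b ell2 \<Rightarrow>\<^sub>L 'b ell2)
    \<Rightarrow> (('a \<times> 'b) ell2 \<Rightarrow>\<^sub>L ('a \<times> 'b) ell2)" where
  "op_tensor A B = (THE C :: ('a \<times> 'b) ell2 \<Rightarrow>\<^sub>L ('a \<times> 'b) ell2.
     \<forall>x y. C (vec_tensor x y) = vec_tensor (A x) (B y))"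


section \<open>Concrete \<open>C\<^sup>*\<close>-algebras\<close>

text \<open>
  The identity of the Hilbert space need not belong to the algebra; in particular an algebra of
  operators on \<open>\<ell>\<^sup>2(S)\<close>, \<open>S \<subseteq> \<Gamma>\<close>, is an algebra of operators on \<open>\<ell>\<^sup>2(\<Gamma>)\<close> by extending every operator
  by zero on the orthogonal complement of \<open>\<ell>\<^sup>2(S)\<close>. A unit of the algebra is therefore a
  (unique) element \<open>u\<close> that acts as a unit on the elements of the algebra.
\<close>

definition cstar_algebra :: "('a ell2 \<Rightarrow>\<^sub>L 'a ell2) set \<Rightarrow> bool" where
  "cstar_algebra \<A> \<longleftrightarrow>
     (\<forall>a\<in>\<A>. clinear_op a) \<and> 0 \<in> \<A> \<and>
     (\<forall>a\<in>\<A>. \<forall>b\<in>\<A>. a + b \<in> \<A>) \<and>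
     (\<forall>c. \<forall>a\<in>\<A>. c *\<^sub>O a \<in> \<A>) \<and>
     (\<forall>a\<in>\<A>. \<forall>b\<in>\<A>. a o\<^sub>L b \<in> \<A>) \<and>
     (\<forall>a\<in>\<A>. adj a \<in> \<A>) \<and>
     closed \<A>"

definition is_unit_of :: "('a ell2 \<Rightarrow>\<^sub>L 'a ell2) set \<Rightarrow> ('a ell2 \<Rightarrow>\<^sub>L 'a ell2) \<Rightarrow> bool" where
  "is_unit_of \<A> u \<longleftrightarrow> u \<in> \<A> \<and> (\<forall>a\<in>\<A>. u o\<^sub>L a = a \<and> a o\<^sub>L u = a)"

definition unital_cstar_algebra :: "('a ell2 \<Rightarrow>\<^sub>L 'a ell2) set \<Rightarrow> bool" where
  "unital_cstar_algebra \<A> \<longleftrightarrow> cstar_algebra \<A> \<and> (\<exists>u. is_unit_of \<A> u)"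

definition generated_cstar_algebra :: "('a ell2 \<Rightarrow>\<^sub>L 'a ell2) set \<Rightarrow> ('a ell2 \<Rightarrow>\<^sub>L 'a ell2) set" where
  "generated_cstar_algebra X = \<Inter>{\<A>. cstar_algebra \<A> \<and> X \<subseteq> \<A>}"

text \<open>The minimal (spatial) tensor product: the norm closure of the algebraic tensor product.\<close>

definition min_tensor :: "('a ell2 \<Rightarrow>\<^sub>L 'a ell2) set \<Rightarrow> ('b ell2 \<Rightarrow>\<^sub>L 'b ell2) set
    \<Rightarrow> (('a \<times> 'b) ell2 \<Rightarrow>\<^sub>L ('a \<times> 'b) ell2) set" where
  "min_tensor \<A> \<B> = closure {t. \<exists>(n::nat) a b. (\<forall>i<n. a i \<in> \<A> \<and> b i \<in> \<B>) \<and>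
     t = (\<Sum>i<n. op_tensor (a i) (b i))}"

definition unital_star_hom :: "('a ell2 \<Rightarrow>\<^sub>L 'a ell2) set \<Rightarrow> ('b ell2 \<Rightarrow>\<^sub>L 'b ell2) set
    \<Rightarrow> (('a ell2 \<Rightarrow>\<^sub>L 'a ell2) \<Rightarrow> ('b ell2 \<Rightarrow>\<^sub>L 'b ell2)) \<Rightarrow> bool" where
  "unital_star_hom \<A> \<B> \<Phi> \<longleftrightarrow>
     (\<forall>a\<in>\<A>. \<Phi> a \<in> \<B>) \<and>
     (\<forall>a\<in>\<A>. \<forall>b\<in>\<A>. \<Phi> (a + b) = \<Phi> a + \<Phi> b) \<and>
     (\<forall>c. \<forall>a\<in>\<A>. \<Phi> (c *\<^sub>O a) = c *\<^sub>O \<Phi> a) \<and>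
     (\<forall>a\<in>\<A>. \<forall>b\<in>\<A>. \<Phi> (a o\<^sub>L b) = \<Phi> a o\<^sub>L \<Phi> b) \<and>
     (\<forall>a\<in>\<A>. \<Phi> (adj a) = adj (\<Phi> a)) \<and>
     (\<forall>u. is_unit_of \<A> u \<longrightarrow> is_unit_of \<B> (\<Phi> u))"


section \<open>Dual spaces and Banach algebras of functionals\<close>

text \<open>Functionals on \<open>\<A>\<close> are represented by functions vanishing outside \<open>\<A>\<close>.\<close>

definition dual :: "('a ell2 \<Rightarrow>\<^sub>L 'a ell2) set \<Rightarrow> (('a ell2 \<Rightarrow>\<^sub>L 'a ell2) \<Rightarrow> complex) set" where
  "dual \<A> = {\<xi>. (\<forall>a. a \<notin> \<A> \<longrightarrow> \<xi> a = 0) \<and>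
     (\<forall>a\<in>\<A>. \<forall>b\<in>\<A>. \<xi> (a + b) = \<xi> a + \<xi> b) \<and>
     (\<forall>c. \<forall>a\<in>\<A>. \<xi> (c *\<^sub>O a) = c * \<xi> a) \<and>
     (\<exists>K. \<forall>a\<in>\<A>. cmod (\<xi> a) \<le> K * norm a)}"

definition dual_norm ::
    "('a ell2 \<Rightarrow>\<^sub>L 'a ell2) set \<Rightarrow> (('a ell2 \<Rightarrow>\<^sub>L 'a ell2) \<Rightarrow> complex) \<Rightarrow> real" where
  "dual_norm \<A> \<xi> = (SUP a\<in>{a\<in>\<A>. norm a \<le> 1}. cmod (\<xi> a))"

definition functional_tensor :: "('a ell2 \<Rightarrow>\<^sub>L 'a ell2) set \<Rightarrow> ('b ell2 \<Rightarrow>\<^sub>L 'b ell2) set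
    \<Rightarrow> (('a ell2 \<Rightarrow>\<^sub>L 'a ell2) \<Rightarrow> complex) \<Rightarrow> (('b ell2 \<Rightarrow>\<^sub>L 'b ell2) \<Rightarrow> complex)
    \<Rightarrow> (('a \<times> 'b) ell2 \<Rightarrow>\<^sub>L ('a \<times> 'b) ell2) \<Rightarrow> complex" where
  "functional_tensor \<A> \<B> \<xi> \<eta> = (THE \<phi>. \<phi> \<in> dual (min_tensor \<A> \<B>) \<and>
     (\<forall>a\<in>\<A>. \<forall>b\<in>\<B>. \<phi> (op_tensor a b) = \<xi> a * \<eta> b))"

definition convolution :: "('a ell2 \<Rightarrow>\<^sub>L 'a ell2) set
    \<Rightarrow> (('a ell2 \<Rightarrow>\<^sub>L 'a ell2) \<Rightarrow> (('a \<times> 'a) ell2 \<Rightarrow>\<^sub>L ('a \<times> 'a) ell2))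
    \<Rightarrow> (('a ell2 \<Rightarrow>\<^sub>L 'a ell2) \<Rightarrow> complex) \<Rightarrow> (('a ell2 \<Rightarrow>\<^sub>L 'a ell2) \<Rightarrow> complex)
    \<Rightarrow> (('a ell2 \<Rightarrow>\<^sub>L 'a ell2) \<Rightarrow> complex)" where
  "convolution \<A> \<Delta> \<xi> \<eta> = (\<lambda>a. if a \<in> \<A> then functional_tensor \<A> \<A> \<xi> \<eta> (\<Delta> a) else 0)"

text \<open>
  A complex Banach algebra whose underlying vector space is a set \<open>D\<close> of complex-valued functions
  with the pointwise linear structure, with norm \<open>N\<close> and product \<open>m\<close>. No unit is required.
\<close>

definition banach_algebra_of_functions :: "('b \<Rightarrow> complex) set \<Rightarrow> (('b \<Rightarrow> complex) \<Rightarrow> real)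
    \<Rightarrow> (('b \<Rightarrow> complex) \<Rightarrow> ('b \<Rightarrow> complex) \<Rightarrow> ('b \<Rightarrow> complex)) \<Rightarrow> bool" where
  "banach_algebra_of_functions D N m \<longleftrightarrow>
     (\<lambda>_. 0) \<in> D \<and>
     (\<forall>f\<in>D. \<forall>g\<in>D. (\<lambda>a. f a + g a) \<in> D) \<and>
     (\<forall>c. \<forall>f\<in>D. (\<lambda>a. c * f a) \<in> D) \<and>
     (\<forall>f\<in>D. 0 \<le> N f \<and> (N f = 0 \<longleftrightarrow> f = (\<lambda>_. 0))) \<and>
     (\<forall>f\<in>D. \<forall>g\<in>D. N (\<lambda>a. f a + g a) \<le> N f + N g) \<and>
     (\<forall>c. \<forall>f\<in>D. N (\<lambda>a. c * f a) = cmod c * N f) \<and>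
     (\<forall>F::nat \<Rightarrow> 'b \<Rightarrow> complex. (\<forall>n. F n \<in> D) \<and>
        (\<forall>e>0. \<exists>M. \<forall>k\<ge>M. \<forall>n\<ge>M. N (\<lambda>a. F k a - F n a) < e) \<longrightarrow>
        (\<exists>f\<in>D. (\<lambda>n. N (\<lambda>a. F n a - f a)) \<longlonglongrightarrow> 0)) \<and>
     (\<forall>f\<in>D. \<forall>g\<in>D. m f g \<in> D) \<and>
     (\<forall>f\<in>D. \<forall>g\<in>D. \<forall>h\<in>D. m (m f g) h = m f (m g h)) \<and>
     (\<forall>f\<in>D. \<forall>g\<in>D. \<forall>h\<in>D. m (\<lambda>a. f a + g a) h = (\<lambda>a. m f h a + m g h a) \<and>
        m h (\<lambda>a. f a + g a) = (\<lambda>a. m h f a + m h g a)) \<and>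
     (\<forall>c. \<forall>f\<in>D. \<forall>g\<in>D. m (\<lambda>a. c * f a) g = (\<lambda>a. c * m f g a) \<and>
        m f (\<lambda>a. c * g a) = (\<lambda>a. c * m f g a)) \<and>
     (\<forall>f\<in>D. \<forall>g\<in>D. N (m f g) \<le> N f * N g)"

definition compact_quantum_semigroup :: "('a ell2 \<Rightarrow>\<^sub>L 'a ell2) set
    \<Rightarrow> (('a ell2 \<Rightarrow>\<^sub>L 'a ell2) \<Rightarrow> (('a \<times> 'a) ell2 \<Rightarrow>\<^sub>L ('a \<times> 'a) ell2)) \<Rightarrow> bool" where
  "compact_quantum_semigroup \<A> \<Delta> \<longleftrightarrow>
     unital_cstar_algebra \<A> \<and>
     unital_star_hom \<A> (min_tensor \<A> \<A>) \<Delta> \<and>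
     inj_on \<Delta> \<A> \<and>
     banach_algebra_of_functions (dual \<A>) (dual_norm \<A>) (convolution \<A> \<Delta>)"


section \<open>The reduced semigroup \<open>C\<^sup>*\<close>-algebra\<close>

text \<open>
  The operator \<open>isom S a\<close> is \<open>T\<^sub>a\<close>, defined on \<open>\<ell>\<^sup>2(\<Gamma>)\<close> by \<open>T\<^sub>a e\<^sub>b = e\<^bsub>a+b\<^esub>\<close> for \<open>b \<in> S\<close> and
  \<open>T\<^sub>a e\<^sub>b = 0\<close> for \<open>b \<notin> S\<close>.
\<close>

definition isom :: "'g::ab_group_add set \<Rightarrow> 'g \<Rightarrow> ('g ell2 \<Rightarrow>\<^sub>L 'g ell2)" where
  "isom S a = Blinfun (\<lambda>x. Abs_ell2 (\<lambda>g. if g - a \<in> S then coord x (g - a) else 0))"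

lemma
  fixes x :: "'g::ab_group_add ell2"
  shows coord_isom: "coord (isom S a x) = (\<lambda>g. if g - a \<in> S then coord x (g - a) else 0)"
    and isom_ket: "isom S a (ket b) = (if b \<in> S then ket (a + b) else 0)"
proof -
  have bij: "bij_betw (\<lambda>g. g - a) UNIV (UNIV :: 'g set)"
    by (rule bij_betw_byWitness[where f' = "\<lambda>g. g + a"]) auto
  let ?f = "\<lambda>(x::'g ell2) g. if g - a \<in> S then coord x (g - a) else 0"
  have le: "(cmod (?f x g))\<^sup>2 \<le> (cmod (coord x (g - a)))\<^sup>2" for x g by simp
  have sum: "(\<lambda>g. (cmod (coord x (g - a)))\<^sup>2) summable_on UNIV" for x :: "'g ell2"
    using summable_on_reindex_bij_betw[OF bij, of "\<lambda>g. (cmod (coord x g))\<^sup>2"]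
    by (simp add: coord_square_summable)
  have f_sum: "(\<lambda>g. (cmod (?f x g))\<^sup>2) summable_on UNIV" for x
    by (rule summable_on_comparison_test[OF sum le]) simp
  have co: "coord (Abs_ell2 (?f x)) = ?f x" for x
    by (rule coord_Abs_ell2[OF f_sum])
  have "bounded_linear (\<lambda>x. Abs_ell2 (?f x))"
  proof (rule bounded_linear_intro)
    fix x y :: "'g ell2" and r :: real
    show "Abs_ell2 (?f (x + y)) = Abs_ell2 (?f x) + Abs_ell2 (?f y)"
      by (rule ell2_eqI) (subst co[of "x + y"], simp add: co)
    show "Abs_ell2 (?f (r *\<^sub>R x)) = r *\<^sub>R Abs_ell2 (?f x)"
      by (rule ell2_eqI) (subst co[of "r *\<^sub>R x"], simp add: co)
    have "(norm (Abs_ell2 (?f x)))\<^sup>2 = (\<Sum>\<^sub>\<infinity>g. (cmod (?f x g))\<^sup>2)"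
      by (simp only: norm_ell2_square co)
    also have "\<dots> \<le> (\<Sum>\<^sub>\<infinity>g. (cmod (coord x (g - a)))\<^sup>2)"
      by (rule infsum_mono[OF f_sum sum le])
    also have "\<dots> = (norm x)\<^sup>2"
      unfolding norm_ell2_square by (rule infsum_reindex_bij_betw[OF bij])
    finally have "norm (Abs_ell2 (?f x)) \<le> norm x"
      by (rule power2_le_imp_le) simp
    then show "norm (Abs_ell2 (?f x)) \<le> norm x * 1" by simp
  qed
  then have app: "isom S a x = Abs_ell2 (?f x)" for x
    by (simp only: isom_def bounded_linear_Blinfun_apply)
  show "coord (isom S a x) = ?f x" unfolding app by (rule co)
  have "i - a = b \<longleftrightarrow> i = a + b" for i :: 'g
    by (auto simp: algebra_simps)
  then show "isom S a (ket b) = (if b \<in> S then ket (a + b) else 0)"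
    unfolding app by (intro ell2_eqI, subst co[of "ket b"]) auto
qed

definition cstar_red :: "'g::ab_group_add set \<Rightarrow> ('g ell2 \<Rightarrow>\<^sub>L 'g ell2) set" where
  "cstar_red S = generated_cstar_algebra (isom S ` S)"

inductive_set monomials :: "'g::ab_group_add set \<Rightarrow> ('g ell2 \<Rightarrow>\<^sub>L 'g ell2) set"
  for S :: "'g set" where
  isom: "a \<in> S \<Longrightarrow> isom S a \<in> monomials S"
| adj_isom: "b \<in> S \<Longrightarrow> adj (isom S b) \<in> monomials S"
| mult: "V \<in> monomials S \<Longrightarrow> W \<in> monomials S \<Longrightarrow> V o\<^sub>L W \<in> monomials S"

end

theory Submission
  imports Defs
begin

text \<open>
  Linear combinations of monomials are dense in \<open>C\<^sup>*\<^bsub>red\<^esub>(S)\<close>, so by continuity \<open>\<Delta>\<close> is a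
  \<open>*\<close>-homomorphism. A monomial maps a basis vector to a basis vector or to \<open>0\<close>; hence the isometry
  \<open>J e\<^sub>g = e\<^sub>g \<otimes> e\<^sub>g\<close> satisfies \<open>(V \<otimes> V) J = J V\<close> for monomials \<open>V\<close>, and \<open>\<Delta>(A) J = J A\<close> for all \<open>A\<close>,
  which makes \<open>\<Delta>\<close> injective.

  For bounded functionals \<open>\<xi>\<close>, \<open>\<eta>\<close> and \<open>t\<close> in the spatial tensor product, the sesquilinear form
  \<open>(y, x) \<mapsto> \<xi>((id \<otimes> \<omega>\<^bsub>y,x\<^esub>)(t))\<close> is given by an operator \<open>(\<xi> \<otimes> id)(t)\<close> of norm at most
  \<open>\<parallel>\<xi>\<parallel> \<parallel>t\<parallel>\<close>, so \<open>(\<xi> \<otimes> \<eta>)(t) = \<eta>((\<xi> \<otimes> id)(t))\<close> is bounded by \<open>\<parallel>\<xi>\<parallel> \<parallel>\<eta>\<parallel> \<parallel>t\<parallel>\<close>. As \<open>\<Delta>\<close> is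
  contractive, the product on the dual space is submultiplicative. The product satisfies
  \<open>(\<xi> \<times> \<eta>)(V) = \<xi>(V) \<eta>(V)\<close> on monomials, and a bounded functional is determined by its values there,
  whence the algebraic laws.
\<close>

section \<open>Vectors\<close>

text \<open>The real Cauchy-Schwarz inequality controls only the real part of
  \<open>cinner x y\<close>. Rotating \<open>y\<close> by the phase \<open>u\<close> turns the value
  into the nonnegative real \<open>cmod (cinner x y)\<close> without changing the norm of
  \<open>y\<close>.\<close>

lemma cmod_cinner_le: "cmod (cinner x y) \<le> norm x * norm y"
proof (cases "cinner x y = 0")
  case False
  define z where "z = cinner x y"
  define u where "u = cnj z / cmod z"
  have z: "z \<noteq> 0" using False by (simp add: z_def)
  have "cnj z * z = complex_of_real ((cmod z)\<^sup>2)"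
    by (metis complex_norm_square mult.commute of_real_power)
  then have "u * z = complex_of_real (cmod z)"
    using z by (simp add: u_def power2_eq_square)
  then have "inner x (u *\<^sub>C y) = cmod z"
    by (simp add: inner_ell2_def cinner_scaleC_right z_def)
  moreover have "inner x (u *\<^sub>C y) \<le> norm x * norm (u *\<^sub>C y)"
    by (rule norm_cauchy_schwarz)
  moreover have "cmod u = 1" using z by (simp add: u_def norm_divide)
  ultimately show ?thesis by (simp add: norm_scaleC z_def)
qed simp

interpretation cinner: bounded_bilinear cinner
  by (rule bounded_bilinear.intro)
    (auto intro!: exI[of _ 1] simp: cinner_add_left cinner_add_right scaleR_ell2_def
      cinner_scaleC_left cinner_scaleC_right scaleR_conv_of_real cmod_cinner_le)

interpretation scaleC: bounded_bilinear "(*\<^sub>C)"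
  by (rule bounded_bilinear.intro)
    (auto intro!: exI[of _ 1] ell2_eqI simp: norm_scaleC algebra_simps scaleR_conv_of_real)

lemma scaleC_scaleC [simp]: "c *\<^sub>C d *\<^sub>C x = (c * d) *\<^sub>C x"
  by (rule ell2_eqI) simp

lemma scaleC_one [simp]: "1 *\<^sub>C x = x"
  by (rule ell2_eqI) simp

lemma coord_sum: "coord (\<Sum>k\<in>F. f k) i = (\<Sum>k\<in>F. coord (f k) i)"
  by (induction F rule: infinite_finite_induct) auto

lemma cinner_ket_left [simp]: "cinner (ket i) x = coord x i"
proof -
  have "cinner (ket i) x = (\<Sum>\<^sub>\<infinity>j\<in>{i}. coord x j)"
    unfolding cinner_def by (rule infsum_cong_neutral) auto
  then show ?thesis by simp
qed

lemma cinner_eqI: "(\<And>y. cinner y x = cinner y z) \<Longrightarrow> x = z"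
  by (rule ell2_eqI) (metis cinner_ket_left)

lemma cinner_self_norm: "cinner x x = complex_of_real ((norm x)\<^sup>2)"
  by (simp only: norm_ell2_square cinner_self)

text \<open>Pythagoras: removing the coordinates in a finite set \<open>F\<close> leaves a vector
  whose squared norm is \<open>(norm x)\<^sup>2\<close> minus the partial sum over \<open>F\<close>,
  and these partial sums converge to \<open>(norm x)\<^sup>2\<close>.\<close>

lemma has_sum_ket: "((\<lambda>i. coord x i *\<^sub>C ket i) has_sum x) UNIV"
proof -
  let ?s = "\<lambda>F. \<Sum>i\<in>F. coord x i *\<^sub>C ket i"
  let ?f = "\<lambda>i. (cmod (coord x i))\<^sup>2"
  have norm: "(norm (x - ?s F))\<^sup>2 = (norm x)\<^sup>2 - sum ?f F" if "finite F" for F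
  proof -
    have "coord (?s F) i = (if i \<in> F then coord x i else 0)" for i
      using that by (simp add: coord_sum if_distrib[of "(*) _"] sum.delta cong: if_cong)
    then have "(norm (x - ?s F))\<^sup>2 = (\<Sum>\<^sub>\<infinity>i. if i \<in> F then 0 else ?f i)"
      unfolding norm_ell2_square by (intro infsum_cong) simp
    also have "\<dots> = (\<Sum>\<^sub>\<infinity>i\<in>UNIV - F. ?f i)"
      by (rule infsum_cong_neutral) auto
    also have "\<dots> = (norm x)\<^sup>2 - sum ?f F"
      using that by (simp add: infsum_Diff coord_square_summable norm_ell2_square)
    finally show ?thesis .
  qed
  have "(sum ?f \<longlongrightarrow> (norm x)\<^sup>2) (finite_subsets_at_top UNIV)"
    using has_sum_infsum[OF coord_square_summable[of x]]
    by (simp add: has_sum_def norm_ell2_square)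
  then have "((\<lambda>F. sqrt ((norm x)\<^sup>2 - sum ?f F)) \<longlongrightarrow> sqrt ((norm x)\<^sup>2 - (norm x)\<^sup>2))
      (finite_subsets_at_top UNIV)"
    by (intro tendsto_intros)
  then have "((\<lambda>F. sqrt ((norm x)\<^sup>2 - sum ?f F)) \<longlongrightarrow> 0) (finite_subsets_at_top UNIV)"
    by simp
  moreover have "\<forall>\<^sub>F F in finite_subsets_at_top UNIV.
      sqrt ((norm x)\<^sup>2 - sum ?f F) = norm (?s F - x)"
  proof (rule eventually_finite_subsets_at_top_weakI)
    fix F :: "'a set" assume "finite F"
    then show "sqrt ((norm x)\<^sup>2 - sum ?f F) = norm (?s F - x)"
      by (subst norm[symmetric]) (simp_all add: norm_minus_commute)
  qed
  ultimately have "((\<lambda>F. norm (?s F - x)) \<longlongrightarrow> 0) (finite_subsets_at_top UNIV)"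
    by (rule Lim_transform_eventually)
  then show ?thesis
    unfolding has_sum_def by (metis tendsto_norm_zero_cancel LIM_zero_cancel)
qed

text \<open>Bounded operators of this type are a priori only real-linear, so they are tested on all
  complex multiples of basis vectors; the expansion of \<open>x\<close> in the basis then gives
  agreement at every \<open>x\<close>.\<close>

lemma blinfun_eqI_ket:
  fixes A B :: "'a ell2 \<Rightarrow>\<^sub>L 'b::real_normed_vector"
  assumes "\<And>c i. A (c *\<^sub>C ket i) = B (c *\<^sub>C ket i)"
  shows "A = B"
proof (rule blinfun_eqI)
  fix x
  have "((\<lambda>i. C (coord x i *\<^sub>C ket i)) has_sum C x) UNIV" for C :: "'a ell2 \<Rightarrow>\<^sub>L 'b"
    using has_sum_bounded_linear[OF blinfun.bounded_linear_right has_sum_ket] .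
  from this[of A] this[of B] show "A x = B x"
    using assms by (auto intro: has_sum_unique)
qed

section \<open>Elementary tensors and square sums over pairs\<close>

lemma ket_pair: "ket (i, j) = vec_tensor (ket i) (ket j)"
  by (rule ell2_eqI) (auto split: prod.splits)

lemma vec_tensor_scaleC_left: "vec_tensor (c *\<^sub>C x) y = c *\<^sub>C vec_tensor x y"
  by (rule ell2_eqI) (auto split: prod.splits)

lemma vec_tensor_scaleC_right: "vec_tensor x (c *\<^sub>C y) = c *\<^sub>C vec_tensor x y"
  by (rule ell2_eqI) (auto split: prod.splits)

text \<open>A complex multiple of a basis vector of the product is itself an elementary tensor,
  since the scalar can be absorbed into the first factor.\<close>

lemma blinfun_eqI_tensor:
  fixes A B :: "('a \<times> 'b) ell2 \<Rightarrow>\<^sub>L 'c::real_normed_vector"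
  assumes "\<And>x y. A (vec_tensor x y) = B (vec_tensor x y)"
  shows "A = B"
proof (rule blinfun_eqI_ket)
  fix c and i :: "'a \<times> 'b"
  show "A (c *\<^sub>C ket i) = B (c *\<^sub>C ket i)"
    using assms[of "c *\<^sub>C ket (fst i)" "ket (snd i)"]
    by (simp add: vec_tensor_scaleC_left flip: ket_pair)
qed

text \<open>Fubini for square sums, with \<open>s i\<close> the squared norm of row
  \<open>i\<close>. It serves to construct operators into \<open>l^2\<close> of a product row by row
  and to compute their norms.\<close>

lemma square_summable_pair:
  assumes "\<And>i. ((\<lambda>j. (cmod (f (i, j)))\<^sup>2) has_sum s i) UNIV" and "s summable_on UNIV"
  shows "(\<lambda>p. (cmod (f p))\<^sup>2) summable_on UNIV"
    and "(\<Sum>\<^sub>\<infinity>p. (cmod (f p))\<^sup>2) = (\<Sum>\<^sub>\<infinity>i. s i)"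
proof -
  have "(\<lambda>p. (cmod (f p))\<^sup>2) summable_on UNIV \<times> UNIV"
    by (rule summable_on_SigmaI[OF _ assms(2)]) (use assms(1) in auto)
  moreover from this have "(\<Sum>\<^sub>\<infinity>p\<in>UNIV \<times> UNIV. (cmod (f p))\<^sup>2) = (\<Sum>\<^sub>\<infinity>i. s i)"
    using assms(1)[THEN infsumI] infsum_Sigma_banach[of "\<lambda>p. (cmod (f p))\<^sup>2" UNIV "\<lambda>_. UNIV"] by simp
  ultimately show "(\<lambda>p. (cmod (f p))\<^sup>2) summable_on UNIV"
    "(\<Sum>\<^sub>\<infinity>p. (cmod (f p))\<^sup>2) = (\<Sum>\<^sub>\<infinity>i. s i)" by simp_all
qed

lemma cinner_vec_tensor:
  "cinner (vec_tensor x y) (vec_tensor x' y') = cinner x x' * cinner y y'"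
proof -
  have "cinner (vec_tensor x y) (vec_tensor x' y')
      = (\<Sum>\<^sub>\<infinity>p\<in>UNIV \<times> UNIV. cnj (coord (vec_tensor x y) p) * coord (vec_tensor x' y') p)"
    by (simp add: cinner_def)
  also have "\<dots> = (\<Sum>\<^sub>\<infinity>i. \<Sum>\<^sub>\<infinity>j. (cnj (coord x i) * coord x' i) * (cnj (coord y j) * coord y' j))"
    using coord_prod_summable[of "vec_tensor x y" "vec_tensor x' y'"]
      infsum_Sigma_banach[of "\<lambda>p. cnj (coord (vec_tensor x y) p) * coord (vec_tensor x' y') p"
        UNIV "\<lambda>_. UNIV"]
    by (simp add: mult_ac)
  also have "\<dots> = cinner x x' * cinner y y'"
    by (simp add: cinner_def infsum_cmult_right' infsum_cmult_left')
  finally show ?thesis .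
qed

lemma norm_vec_tensor: "norm (vec_tensor x y) = norm x * norm y"
proof -
  have "complex_of_real ((norm (vec_tensor x y))\<^sup>2) = complex_of_real ((norm x * norm y)\<^sup>2)"
    unfolding cinner_self_norm[symmetric] cinner_vec_tensor
    by (simp add: cinner_self_norm power_mult_distrib)
  then have "(norm (vec_tensor x y))\<^sup>2 = (norm x * norm y)\<^sup>2"
    by (simp only: of_real_eq_iff)
  then show ?thesis by (simp add: power2_eq_iff_nonneg)
qed

interpretation vec_tensor: bounded_bilinear vec_tensor
  by (rule bounded_bilinear.intro)
    (auto intro!: exI[of _ 1] ell2_eqI
      simp: norm_vec_tensor vec_tensor_scaleC_left vec_tensor_scaleC_right algebra_simps)


section \<open>Adjoints\<close>

lemma clinear_opD:
  fixes A :: "'a ell2 \<Rightarrow>\<^sub>L 'b ell2"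
  shows "clinear_op A \<Longrightarrow> A (c *\<^sub>C x) = c *\<^sub>C A x"
  by (simp add: clinear_op_def)

lemma clinear_op_zero [simp]: "clinear_op 0"
  by (simp add: clinear_op_def ell2_eqI)

lemma clinear_op_add: "clinear_op A \<Longrightarrow> clinear_op B \<Longrightarrow> clinear_op (A + B)"
  by (simp add: clinear_op_def blinfun.add_left scaleC.add_right)

lemma clinear_op_scale: "clinear_op A \<Longrightarrow> clinear_op (c *\<^sub>O A)"
  by (simp add: clinear_op_def mult.commute)

lemma clinear_op_comp: "clinear_op A \<Longrightarrow> clinear_op B \<Longrightarrow> clinear_op (A o\<^sub>L B)"
  by (simp add: clinear_op_def)

lemma closed_clinear_op: "closed {A. clinear_op A}"
  unfolding clinear_op_def
  by (intro closed_Collect_all closed_Collect_eq continuous_intros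
      scaleC.continuous_on)

lemma scale_op_add_right: "c *\<^sub>O (A + B) = c *\<^sub>O A + c *\<^sub>O B"
  by (rule blinfun_eqI) (simp add: blinfun.add_left scaleC.add_right)

lemma scale_op_scale_op [simp]: "c *\<^sub>O d *\<^sub>O A = (c * d) *\<^sub>O A"
  by (rule blinfun_eqI) simp

lemma scale_op_zero [simp]: "c *\<^sub>O 0 = 0"
  by (rule blinfun_eqI) (simp add: scaleC.zero_right)

lemma norm_scale_op: "norm (c *\<^sub>O A) = cmod c * norm A"
proof (rule antisym)
  have le: "norm (c *\<^sub>O A) \<le> cmod c * norm A" for c and A :: "'a ell2 \<Rightarrow>\<^sub>L 'b ell2"
    by (rule norm_blinfun_bound)
      (auto simp: norm_scaleC mult.assoc intro!: mult_left_mono norm_blinfun)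
  show "norm (c *\<^sub>O A) \<le> cmod c * norm A" by (rule le)
  show "cmod c * norm A \<le> norm (c *\<^sub>O A)"
  proof (cases "c = 0")
    case False
    \<comment> \<open>The reverse inequality is the first one, applied to the scalar
      \<open>inverse c\<close> and the operator \<open>c *\<^sub>O A\<close>.\<close>
    then have "A = inverse c *\<^sub>O c *\<^sub>O A"
      by (intro blinfun_eqI) simp
    then have "norm A \<le> inverse (cmod c) * norm (c *\<^sub>O A)"
      using le[of "inverse c" "c *\<^sub>O A"] by (simp only: norm_inverse)
    then show ?thesis
      using False by (simp add: field_simps)
  qed simp
qed

interpretation scale_op: bounded_bilinear "(*\<^sub>O)"
proof (rule bounded_bilinear.intro)
  fix c d r and A B :: "'a ell2 \<Rightarrow>\<^sub>L 'b ell2"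
  show "(c + d) *\<^sub>O A = c *\<^sub>O A + d *\<^sub>O A"
    by (rule blinfun_eqI) (simp add: blinfun.add_left scaleC.add_left)
  show "c *\<^sub>O (A + B) = c *\<^sub>O A + c *\<^sub>O B"
    by (rule scale_op_add_right)
  show "(r *\<^sub>R c) *\<^sub>O A = r *\<^sub>R c *\<^sub>O A"
    by (rule blinfun_eqI) (simp add: blinfun.scaleR_left scaleC.scaleR_left)
  show "c *\<^sub>O r *\<^sub>R A = r *\<^sub>R c *\<^sub>O A"
    by (rule blinfun_eqI) (simp add: blinfun.scaleR_left scaleC.scaleR_right)
  show "\<exists>K. \<forall>c (A :: 'a ell2 \<Rightarrow>\<^sub>L 'b ell2). norm (c *\<^sub>O A) \<le> norm c * norm A * K"
    by (intro exI[of _ 1]) (simp add: norm_scale_op)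
qed

section \<open>Existence and calculus of adjoints\<close>

lemma adj_eqI:
  fixes A :: "'a ell2 \<Rightarrow>\<^sub>L 'b ell2" and B :: "'b ell2 \<Rightarrow>\<^sub>L 'a ell2"
  assumes "\<And>x y. cinner (A x) y = cinner x (B y)"
  shows "adj A = B"
  unfolding adj_def
proof (rule the_equality)
  fix C :: "'b ell2 \<Rightarrow>\<^sub>L 'a ell2"
  assume "\<forall>x y. cinner (A x) y = cinner x (C y)"
  then show "C = B"
    using assms by (intro blinfun_eqI cinner_eqI) metis
qed (use assms in blast)

lemma clinear_op_adjI:
  fixes A :: "'a ell2 \<Rightarrow>\<^sub>L 'b ell2" and B :: "'b ell2 \<Rightarrow>\<^sub>L 'a ell2"
  assumes "\<And>x y. cinner (A x) y = cinner x (B y)"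
  shows "clinear_op B"
  unfolding clinear_op_def
proof (intro allI cinner_eqI)
  fix c x y
  show "cinner y (B (c *\<^sub>C x)) = cinner y (c *\<^sub>C B x)"
    by (simp add: cinner_scaleC_right flip: assms)
qed

text \<open>The coordinates of the adjoint are forced: coordinate \<open>i\<close> of
  \<open>B y\<close> must be \<open>cinner (A (ket i)) y\<close>. What has to be shown is that this
  family is square summable with norm at most \<open>norm A * norm y\<close>; the adjoint relation
  then follows by expanding \<open>x\<close> in the basis.\<close>

lemma adj_exists:
  fixes A :: "'a ell2 \<Rightarrow>\<^sub>L 'b ell2"
  assumes A: "clinear_op A"
  shows "\<exists>B :: 'b ell2 \<Rightarrow>\<^sub>L 'a ell2. \<forall>x y. cinner (A x) y = cinner x (B y)"
proof -
  let ?f = "\<lambda>y i. cinner (A (ket i)) y"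
  have bound: "(\<Sum>i\<in>F. (cmod (?f y i))\<^sup>2) \<le> (norm A * norm y)\<^sup>2" if "finite F" for F y
  proof -
    \<comment> \<open>The truncation \<open>z\<close> of the candidate to \<open>F\<close> is fed
      back into \<open>A\<close>: \<open>(norm z)\<^sup>2\<close> equals
      \<open>cinner (A z) y\<close>, hence is at most \<open>norm A * norm z * norm y\<close>, and
      one factor \<open>norm z\<close> cancels.\<close>
    define z where "z = (\<Sum>i\<in>F. ?f y i *\<^sub>C ket i)"
    have z: "coord z i = (if i \<in> F then ?f y i else 0)" for i
      using that by (simp add: z_def coord_sum if_distrib[of "(*) _"] sum.delta cong: if_cong)
    have nz: "(norm z)\<^sup>2 = (\<Sum>i\<in>F. (cmod (?f y i))\<^sup>2)"
      unfolding norm_ell2_square using that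
      by (subst infsum_cong_neutral[where T = F and g = "\<lambda>i. (cmod (?f y i))\<^sup>2"]) (auto simp: z)
    have cc: "cnj w * w = complex_of_real ((cmod w)\<^sup>2)" for w
      by (metis complex_norm_square mult.commute of_real_power)
    have "cinner (A z) y = (\<Sum>i\<in>F. cnj (?f y i) * ?f y i)"
      by (simp add: z_def blinfun.sum_right clinear_opD[OF A] cinner.sum_left cinner_scaleC_left)
    also have "\<dots> = complex_of_real ((norm z)\<^sup>2)"
      unfolding nz by (simp only: cc of_real_sum)
    finally have "(norm z)\<^sup>2 = cmod (cinner (A z) y)"
      by (simp del: of_real_power)
    also have "\<dots> \<le> norm (A z) * norm y"
      by (rule cmod_cinner_le)
    also have "\<dots> \<le> norm A * norm z * norm y"
      by (intro mult_right_mono norm_blinfun) simp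
    finally have "norm z * norm z \<le> (norm A * norm y) * norm z"
      by (simp add: power2_eq_square mult_ac)
    then have "norm z \<le> norm A * norm y"
      by (cases "z = 0") (simp_all only: mult_le_cancel_right, simp_all)
    then show ?thesis
      unfolding nz[symmetric] by (intro power_mono) auto
  qed
  have summable: "(\<lambda>i. (cmod (?f y i))\<^sup>2) summable_on UNIV" for y
    by (rule nonneg_bdd_above_summable_on) (auto intro!: bdd_aboveI2[OF bound])
  define g where "g y = Abs_ell2 (?f y)" for y
  have g: "coord (g y) = ?f y" for y
    unfolding g_def by (rule coord_Abs_ell2[OF summable])
  have "bounded_linear g"
  proof (rule bounded_linear_intro)
    show "g (x + y) = g x + g y" for x y
      by (rule ell2_eqI) (simp add: g cinner_add_right)
    show "g (r *\<^sub>R x) = r *\<^sub>R g x" for r x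
      by (rule ell2_eqI) (simp add: g scaleR_ell2_def cinner_scaleC_right)
    show "norm (g y) \<le> norm y * norm A" for y
    proof (rule power2_le_imp_le)
      show "(norm (g y))\<^sup>2 \<le> (norm y * norm A)\<^sup>2"
        unfolding norm_ell2_square g using bound
        by (intro infsum_le_finite_sums summable) (auto simp: mult.commute)
    qed simp
  qed
  then have app: "blinfun_apply (Blinfun g) = g"
    by (rule bounded_linear_Blinfun_apply)
  have "cinner (A x) y = cinner x (Blinfun g y)" for x y
  proof -
    have "bounded_linear (\<lambda>x. cinner (A x) y)"
      by (rule bounded_linear_compose[OF cinner.bounded_linear_left blinfun.bounded_linear_right])
    from has_sum_bounded_linear[OF this has_sum_ket[of x]]
    have "((\<lambda>i. cnj (coord x i) * coord (g y) i) has_sum cinner (A x) y) UNIV"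
      by (simp add: clinear_opD[OF A] cinner_scaleC_left g)
    then show ?thesis
      by (simp add: app cinner_def infsumI)
  qed
  then show ?thesis by blast
qed

lemma cinner_adj:
  fixes A :: "'a ell2 \<Rightarrow>\<^sub>L 'b ell2"
  assumes "clinear_op A"
  shows "cinner (A x) y = cinner x (adj A y)"
proof -
  obtain B :: "'b ell2 \<Rightarrow>\<^sub>L 'a ell2" where B: "\<forall>x y. cinner (A x) y = cinner x (B y)"
    using adj_exists[OF assms] by blast
  then have "adj A = B" by (intro adj_eqI) simp
  then show ?thesis using B by simp
qed

lemma cinner_adj':
  fixes A :: "'a ell2 \<Rightarrow>\<^sub>L 'b ell2"
  shows "clinear_op A \<Longrightarrow> cinner (adj A x) y = cinner x (A y)"
  by (metis cinner_adj cinner_commute)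

lemma clinear_op_adj: "clinear_op A \<Longrightarrow> clinear_op (adj A)"
  by (rule clinear_op_adjI[OF cinner_adj])

lemma adj_adj: "clinear_op A \<Longrightarrow> adj (adj A) = A"
  by (rule adj_eqI) (simp add: cinner_adj')

lemma adj_add: "clinear_op A \<Longrightarrow> clinear_op B \<Longrightarrow> adj (A + B) = adj A + adj B"
  by (rule adj_eqI) (simp add: blinfun.add_left cinner_add_left cinner_add_right cinner_adj)

lemma adj_scale: "clinear_op A \<Longrightarrow> adj (c *\<^sub>O A) = cnj c *\<^sub>O adj A"
  by (rule adj_eqI) (simp add: cinner_scaleC_left cinner_scaleC_right cinner_adj)

lemma adj_comp: "clinear_op A \<Longrightarrow> clinear_op B \<Longrightarrow> adj (A o\<^sub>L B) = adj B o\<^sub>L adj A"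
  by (rule adj_eqI) (simp add: cinner_adj)

lemma adj_zero [simp]: "adj 0 = 0"
  by (rule adj_eqI) (simp add: cinner.zero_left cinner.zero_right)

text \<open>The substantial half of the C*-identity: \<open>(norm (A x))\<^sup>2\<close> is the
  inner product of \<open>x\<close> with \<open>adj A (A x)\<close>, to which Cauchy-Schwarz
  applies.\<close>

lemma norm_blinfun_square_le:
  fixes A :: "'a ell2 \<Rightarrow>\<^sub>L 'b ell2"
  assumes A: "clinear_op A"
  shows "(norm A)\<^sup>2 \<le> norm (adj A o\<^sub>L A)"
proof -
  have "norm A \<le> sqrt (norm (adj A o\<^sub>L A))"
  proof (rule norm_blinfun_bound)
    fix x
    have "complex_of_real ((norm (A x))\<^sup>2) = cinner x ((adj A o\<^sub>L A) x)"
      using cinner_adj[OF A, of x "A x"] by (simp add: cinner_self_norm del: of_real_power)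
    then have "(norm (A x))\<^sup>2 = cmod (cinner x ((adj A o\<^sub>L A) x))"
      by (metis norm_of_real abs_of_nonneg zero_le_power2)
    also have "\<dots> \<le> norm x * norm ((adj A o\<^sub>L A) x)"
      by (rule cmod_cinner_le)
    also have "\<dots> \<le> norm x * (norm (adj A o\<^sub>L A) * norm x)"
      by (intro mult_left_mono norm_blinfun) simp
    also have "\<dots> = (sqrt (norm (adj A o\<^sub>L A)) * norm x)\<^sup>2"
      by (simp add: power_mult_distrib power2_eq_square mult_ac)
    finally show "norm (A x) \<le> sqrt (norm (adj A o\<^sub>L A)) * norm x"
      by (rule power2_le_imp_le) simp
  qed simp
  then show ?thesis
    using power_mono[of "norm A" "sqrt (norm (adj A o\<^sub>L A))" 2] by simp
qed


text \<open>Combine the previous inequality with submultiplicativity of the operator norm and cancel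
  \<open>norm A\<close>. Applied also to \<open>adj A\<close>, this makes the adjoint isometric and
  therefore continuous.\<close>

lemma norm_le_norm_adj:
  assumes "clinear_op A"
  shows "norm A \<le> norm (adj A)"
proof -
  have "norm A * norm A \<le> norm (adj A) * norm A"
    using norm_blinfun_square_le[OF assms] norm_blinfun_compose[of "adj A" A]
    by (simp add: power2_eq_square)
  then show ?thesis by (metis mult_right_le_imp_le norm_ge_zero order_le_less)
qed

lemma norm_adj: "clinear_op A \<Longrightarrow> norm (adj A) = norm A"
  using norm_le_norm_adj[of A] norm_le_norm_adj[of "adj A"]
  by (simp add: adj_adj clinear_op_adj)

lemma adj_diff: "clinear_op A \<Longrightarrow> clinear_op B \<Longrightarrow> adj (A - B) = adj A - adj B"
  by (rule adj_eqI) (simp add: blinfun.diff_left cinner.diff_left cinner.diff_right cinner_adj)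

lemma clinear_op_diff: "clinear_op A \<Longrightarrow> clinear_op B \<Longrightarrow> clinear_op (A - B)"
  by (simp add: clinear_op_def blinfun.diff_left scaleC.diff_right)

lemma tendsto_adj:
  assumes "(A \<longlongrightarrow> B) F" and "\<And>n. clinear_op (A n)" and "clinear_op B"
  shows "((\<lambda>n. adj (A n)) \<longlongrightarrow> adj B) F"
proof -
  have "norm (adj (A n) - adj B) = norm (A n - B)" for n
    using assms(2)[of n] assms(3) by (simp add: norm_adj clinear_op_diff flip: adj_diff)
  moreover have "((\<lambda>n. norm (A n - B)) \<longlongrightarrow> 0) F"
    using assms(1) by (intro tendsto_norm_zero) (simp add: LIM_zero_iff)
  ultimately have "((\<lambda>n. norm (adj (A n) - adj B)) \<longlongrightarrow> 0) F"
    by simp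
  then show ?thesis
    by (rule LIM_zero_cancel[OF tendsto_norm_zero_cancel])
qed


section \<open>Tensor products of operators\<close>

text \<open>The operator id \<otimes> B applies \<open>B\<close> to each row
  \<open>coord z (i, _)\<close> separately. Squared norms of rows add up to the squared norm of
  \<open>z\<close>, so the bound for \<open>B\<close> carries over.\<close>

lemma amplification_exists:
  fixes B :: "'b ell2 \<Rightarrow>\<^sub>L 'b ell2"
  assumes B: "clinear_op B"
  shows "\<exists>C :: ('a \<times> 'b) ell2 \<Rightarrow>\<^sub>L ('a \<times> 'b) ell2.
    \<forall>x y. C (vec_tensor x y) = vec_tensor x (B y)"
proof -
  define row where "row z i = Abs_ell2 (\<lambda>j. coord z (i, j))" for z :: "('a \<times> 'b) ell2" and i
  have row_summable: "(\<lambda>j. (cmod (coord z (i, j)))\<^sup>2) summable_on UNIV" for z :: "('a \<times> 'b) ell2" and i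
  proof -
    have "(\<lambda>p. (cmod (coord z p))\<^sup>2) summable_on range (Pair i)"
      by (rule summable_on_subset_banach[OF coord_square_summable]) simp
    then show ?thesis
      by (subst (asm) summable_on_reindex) (auto simp: o_def inj_on_def)
  qed
  have coord_row: "coord (row z i) = (\<lambda>j. coord z (i, j))" for z i
    unfolding row_def by (rule coord_Abs_ell2[OF row_summable])
  have row_norm: "(\<lambda>i. (norm (row z i))\<^sup>2) summable_on UNIV"
    "(\<Sum>\<^sub>\<infinity>i. (norm (row z i))\<^sup>2) = (norm z)\<^sup>2" for z
    using summable_on_Sigma_banach[of "\<lambda>i j. (cmod (coord z (i, j)))\<^sup>2" UNIV "\<lambda>_. UNIV"]
      infsum_Sigma_banach[of "\<lambda>p. (cmod (coord z p))\<^sup>2" UNIV "\<lambda>_. UNIV"]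
      coord_square_summable[of z]
    by (simp_all add: norm_ell2_square coord_row case_prod_unfold)
  define f where "f z = (\<lambda>(i, j). coord (B (row z i)) j)" for z
  have row_sum: "((\<lambda>j. (cmod (f z (i, j)))\<^sup>2) has_sum (norm (B (row z i)))\<^sup>2) UNIV" for z i
    by (simp add: f_def norm_ell2_square coord_square_summable)
  have le: "(norm (B (row z i)))\<^sup>2 \<le> (norm B)\<^sup>2 * (norm (row z i))\<^sup>2" for z i
    using power_mono[OF norm_blinfun[of B "row z i"], of 2] by (simp add: power_mult_distrib)
  have s: "(\<lambda>i. (norm (B (row z i)))\<^sup>2) summable_on UNIV" for z
    by (rule summable_on_comparison_test[OF summable_on_cmult_right[OF row_norm(1)] le]) simp
  define C where "C z = Abs_ell2 (f z)" for z
  have C: "coord (C z) = f z" for z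
    unfolding C_def by (rule coord_Abs_ell2[OF square_summable_pair(1)[OF row_sum s]])
  have "bounded_linear C"
  proof (rule bounded_linear_intro)
    have "row (z + w) i = row z i + row w i" for z w i
      by (rule ell2_eqI) (simp add: coord_row)
    then show "C (z + w) = C z + C w" for z w
      by (intro ell2_eqI) (simp add: C f_def blinfun.add_right split: prod.splits)
    have "row (r *\<^sub>R z) i = r *\<^sub>R row z i" for r z i
      by (rule ell2_eqI) (simp add: coord_row)
    then show "C (r *\<^sub>R z) = r *\<^sub>R C z" for r z
      by (intro ell2_eqI) (simp add: C f_def blinfun.scaleR_right split: prod.splits)
    show "norm (C z) \<le> norm z * norm B" for z
    proof (rule power2_le_imp_le)
      have "(norm (C z))\<^sup>2 = (\<Sum>\<^sub>\<infinity>i. (norm (B (row z i)))\<^sup>2)"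
        unfolding norm_ell2_square[of "C z"] C by (rule square_summable_pair(2)[OF row_sum s])
      also have "\<dots> \<le> (\<Sum>\<^sub>\<infinity>i. (norm B)\<^sup>2 * (norm (row z i))\<^sup>2)"
        by (rule infsum_mono[OF s summable_on_cmult_right[OF row_norm(1)] le])
      also have "\<dots> = (norm z * norm B)\<^sup>2"
        by (simp add: infsum_cmult_right' row_norm power_mult_distrib mult.commute)
      finally show "(norm (C z))\<^sup>2 \<le> (norm z * norm B)\<^sup>2" .
    qed simp
  qed
  then have app: "blinfun_apply (Blinfun C) = C"
    by (rule bounded_linear_Blinfun_apply)
  have "C (vec_tensor x y) = vec_tensor x (B y)" for x y
  proof -
    \<comment> \<open>The rows of an elementary tensor are complex multiples of \<open>y\<close>;
      here complex linearity of \<open>B\<close> enters.\<close>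
    have "row (vec_tensor x y) i = coord x i *\<^sub>C y" for i
      by (rule ell2_eqI) (simp add: coord_row)
    then show ?thesis
      by (intro ell2_eqI) (simp add: C f_def clinear_opD[OF B] split: prod.splits)
  qed
  then show ?thesis
    by (intro exI[of _ "Blinfun C"]) (simp add: app)
qed

text \<open>Conjugation by the flip moves an amplification from the second tensor factor to the
  first.\<close>

lemma flip_exists:
  "\<exists>U :: ('a \<times> 'b) ell2 \<Rightarrow>\<^sub>L ('b \<times> 'a) ell2. \<forall>x y. U (vec_tensor x y) = vec_tensor y x"
proof -
  define U where "U z = Abs_ell2 (\<lambda>(j, i). coord z (i, j))" for z :: "('a \<times> 'b) ell2"
  have bij: "bij_betw prod.swap (UNIV :: ('b \<times> 'a) set) UNIV"
    by simp
  have "(\<lambda>p. (cmod (coord z (prod.swap p)))\<^sup>2) summable_on UNIV" for z :: "('a \<times> 'b) ell2"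
    using summable_on_reindex_bij_betw[OF bij, of "\<lambda>p. (cmod (coord z p))\<^sup>2"]
    by (simp add: coord_square_summable)
  then have U: "coord (U z) = (\<lambda>p. coord z (prod.swap p))" for z
    unfolding U_def by (subst coord_Abs_ell2) (auto simp: case_prod_unfold prod.swap_def)
  have "norm (U z) = norm z" for z
  proof -
    have "(norm (U z))\<^sup>2 = (norm z)\<^sup>2"
      unfolding norm_ell2_square U by (rule infsum_reindex_bij_betw[OF bij])
    then show ?thesis by simp
  qed
  then have "bounded_linear U"
    by (intro bounded_linear_intro[where K = 1] ell2_eqI) (simp_all add: U)
  then have "blinfun_apply (Blinfun U) = U"
    by (rule bounded_linear_Blinfun_apply)
  moreover have "U (vec_tensor x y) = vec_tensor y x" for x y
    by (rule ell2_eqI) (simp add: U split: prod.splits)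
  ultimately show ?thesis
    by (intro exI[of _ "Blinfun U"]) simp
qed

text \<open>This shows that the definite description in \<open>op_tensor\<close> denotes. Uniqueness
  holds because elementary tensors determine an operator.\<close>

lemma op_tensor_apply:
  fixes A :: "'a ell2 \<Rightarrow>\<^sub>L 'a ell2" and B :: "'b ell2 \<Rightarrow>\<^sub>L 'b ell2"
  assumes "clinear_op A" "clinear_op B"
  shows "op_tensor A B (vec_tensor x y) = vec_tensor (A x) (B y)"
proof -
  let ?P = "\<lambda>C :: ('a \<times> 'b) ell2 \<Rightarrow>\<^sub>L ('a \<times> 'b) ell2.
    \<forall>x y. C (vec_tensor x y) = vec_tensor (A x) (B y)"
  obtain C :: "('a \<times> 'b) ell2 \<Rightarrow>\<^sub>L ('a \<times> 'b) ell2"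
    where C: "\<forall>x y. C (vec_tensor x y) = vec_tensor x (B y)"
    using amplification_exists[OF assms(2)] by blast
  obtain D :: "('b \<times> 'a) ell2 \<Rightarrow>\<^sub>L ('b \<times> 'a) ell2"
    where D: "\<forall>x y. D (vec_tensor x y) = vec_tensor x (A y)"
    using amplification_exists[OF assms(1)] by blast
  obtain U :: "('a \<times> 'b) ell2 \<Rightarrow>\<^sub>L ('b \<times> 'a) ell2" where U: "\<forall>x y. U (vec_tensor x y) = vec_tensor y x"
    using flip_exists by blast
  obtain U' :: "('b \<times> 'a) ell2 \<Rightarrow>\<^sub>L ('a \<times> 'b) ell2" where U': "\<forall>x y. U' (vec_tensor x y) = vec_tensor y x"
    using flip_exists by blast
  \<comment> \<open>Apply id \<otimes> B, flip, apply id \<otimes> A, and flip back.\<close>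
  have "?P (U' o\<^sub>L D o\<^sub>L U o\<^sub>L C)"
    by (simp add: C D U U')
  moreover have "E = E'" if "?P E" "?P E'" for E E'
    using that by (intro blinfun_eqI_tensor) simp
  ultimately have "\<exists>!C. ?P C" by blast
  then have "?P (op_tensor A B)"
    unfolding op_tensor_def by (rule theI')
  then show ?thesis by simp
qed

lemma cinner_eqI_tensor:
  assumes "\<And>x y. cinner (vec_tensor x y) v = cinner (vec_tensor x y) w"
  shows "v = w"
proof (rule ell2_eqI)
  fix i :: "'a \<times> 'b"
  show "coord v i = coord w i"
    using assms[of "ket (fst i)" "ket (snd i)"] by (simp flip: ket_pair)
qed

text \<open>Linearity is phrased as an equation between operators, so that it can be tested on
  elementary tensors, where the scalar passes through the first factor.\<close>

lemma clinear_op_op_tensor: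
  assumes "clinear_op A" "clinear_op B"
  shows "clinear_op (op_tensor A B)"
proof -
  have "op_tensor A B o\<^sub>L (c *\<^sub>O id_blinfun) = c *\<^sub>O op_tensor A B" for c
    by (rule blinfun_eqI_tensor)
      (simp add: op_tensor_apply assms clinear_opD flip: vec_tensor_scaleC_left)
  then show ?thesis
    unfolding clinear_op_def by (metis blinfun_apply_blinfun_compose blinfun_apply_id_blinfun scale_op_apply id_apply)
qed

lemma op_tensor_comp:
  assumes "clinear_op A" "clinear_op B" "clinear_op C" "clinear_op D"
  shows "op_tensor A B o\<^sub>L op_tensor C D = op_tensor (A o\<^sub>L C) (B o\<^sub>L D)"
  by (rule blinfun_eqI_tensor) (simp add: op_tensor_apply clinear_op_comp assms)

lemma scale_op_tensor:
  assumes "clinear_op A" "clinear_op B"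
  shows "c *\<^sub>O op_tensor A B = op_tensor (c *\<^sub>O A) B"
  by (rule blinfun_eqI_tensor)
    (simp add: op_tensor_apply clinear_op_scale assms vec_tensor_scaleC_left)

lemma adj_op_tensor:
  assumes "clinear_op A" "clinear_op B"
  shows "adj (op_tensor A B) = op_tensor (adj A) (adj B)"
proof (intro blinfun_eqI_tensor cinner_eqI_tensor)
  fix x y x' y'
  show "cinner (vec_tensor x' y') (adj (op_tensor A B) (vec_tensor x y))
      = cinner (vec_tensor x' y') (op_tensor (adj A) (adj B) (vec_tensor x y))"
    using assms by (simp add: op_tensor_apply clinear_op_adj clinear_op_op_tensor
        cinner_vec_tensor cinner_adj flip: cinner_adj[OF clinear_op_op_tensor])
qed


section \<open>Slices\<close>

text \<open>The adjoint of this map contracts the second tensor factor against \<open>y\<close>; the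
  two together yield slices.\<close>

definition tensor_right :: "'b ell2 \<Rightarrow> 'a ell2 \<Rightarrow>\<^sub>L ('a \<times> 'b) ell2" where
  "tensor_right y = Blinfun (\<lambda>x. vec_tensor x y)"

lemma tensor_right_apply [simp]: "tensor_right y x = vec_tensor x y"
  unfolding tensor_right_def
  by (simp add: bounded_linear_Blinfun_apply vec_tensor.bounded_linear_left)

lemma clinear_op_tensor_right: "clinear_op (tensor_right y)"
  by (simp add: clinear_op_def vec_tensor_scaleC_left)

lemma norm_tensor_right_le: "norm (tensor_right y) \<le> norm y"
  by (rule norm_blinfun_bound) (simp_all add: norm_vec_tensor)

lemma adj_tensor_right: "adj (tensor_right y) (vec_tensor x z) = cinner y z *\<^sub>C x"
proof (rule cinner_eqI)
  fix w
  show "cinner w (adj (tensor_right y) (vec_tensor x z)) = cinner w (cinner y z *\<^sub>C x)"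
    using cinner_adj[OF clinear_op_tensor_right, of y w "vec_tensor x z"]
    by (simp add: cinner_vec_tensor cinner_scaleC_right mult.commute)
qed

text \<open>This is the slice map (id \<otimes> \<omega>)(t) for the vector functional \<omega>(b) =
  \<open>cinner y (b x)\<close>. Written as a composition, it is visibly linear and continuous in
  \<open>t\<close>, with norm at most \<open>norm y * norm t * norm x\<close>.\<close>

definition slice :: "'b ell2 \<Rightarrow> (('a \<times> 'b) ell2 \<Rightarrow>\<^sub>L ('a \<times> 'b) ell2) \<Rightarrow> 'b ell2
    \<Rightarrow> ('a ell2 \<Rightarrow>\<^sub>L 'a ell2)" where
  "slice y t x = adj (tensor_right y) o\<^sub>L t o\<^sub>L tensor_right x"

lemma slice_add: "slice y (t + u) x = slice y t x + slice y u x"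
  by (rule blinfun_eqI) (simp add: slice_def blinfun.add_left blinfun.add_right)

lemma slice_diff: "slice y (t - u) x = slice y t x - slice y u x"
  by (rule blinfun_eqI) (simp add: slice_def blinfun.diff_left blinfun.diff_right)

lemma slice_zero [simp]: "slice y 0 x = 0"
  by (rule blinfun_eqI) (simp add: slice_def)

lemma slice_scale: "slice y (c *\<^sub>O t) x = c *\<^sub>O slice y t x"
  by (rule blinfun_eqI)
    (simp add: slice_def clinear_opD clinear_op_adj clinear_op_tensor_right)

lemma norm_slice_le:
  fixes t :: "('a \<times> 'b) ell2 \<Rightarrow>\<^sub>L ('a \<times> 'b) ell2"
  shows "norm (slice y t x) \<le> norm y * norm t * norm x"
proof -
  let ?R = "tensor_right :: 'b ell2 \<Rightarrow> 'a ell2 \<Rightarrow>\<^sub>L ('a \<times> 'b) ell2"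
  have "norm (slice y t x) \<le> norm (adj (?R y) o\<^sub>L t) * norm (?R x)"
    unfolding slice_def by (rule norm_blinfun_compose)
  also have "\<dots> \<le> norm (adj (?R y)) * norm t * norm (?R x)"
    by (intro mult_right_mono norm_blinfun_compose norm_ge_zero)
  also have "\<dots> \<le> norm y * norm t * norm x"
    by (intro mult_mono) (simp_all add: norm_adj clinear_op_tensor_right norm_tensor_right_le)
  finally show ?thesis .
qed

lemma slice_op_tensor:
  assumes "clinear_op a" "clinear_op b"
  shows "slice y (op_tensor a b) x = cinner y (b x) *\<^sub>O a"
  by (rule blinfun_eqI) (simp add: slice_def op_tensor_apply assms adj_tensor_right)

lemma tendsto_slice: "(f \<longlongrightarrow> t) F \<Longrightarrow> ((\<lambda>n. slice y (f n) x) \<longlongrightarrow> slice y t x) F"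
  unfolding slice_def
  by (intro bounded_linear.tendsto[OF bounded_bilinear.bounded_linear_left[OF bounded_bilinear_blinfun_compose]]
      bounded_linear.tendsto[OF bounded_bilinear.bounded_linear_right[OF bounded_bilinear_blinfun_compose]])


section \<open>Spaces of operators and their duals\<close>

text \<open>Complex subspaces. The notion covers C*-algebras, algebraic and spatial tensor products
  and the span of the monomials, so that facts on dual spaces apply to all of them.\<close>

definition op_space :: "('a ell2 \<Rightarrow>\<^sub>L 'a ell2) set \<Rightarrow> bool" where
  "op_space D \<longleftrightarrow> 0 \<in> D \<and> (\<forall>a\<in>D. \<forall>b\<in>D. a + b \<in> D) \<and> (\<forall>c. \<forall>a\<in>D. c *\<^sub>O a \<in> D)"

lemma op_spaceD:
  assumes "op_space D"
  shows "0 \<in> D" and "a \<in> D \<Longrightarrow> b \<in> D \<Longrightarrow> a + b \<in> D" and "a \<in> D \<Longrightarrow> c *\<^sub>O a \<in> D"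
  using assms by (auto simp: op_space_def)

lemma minus_scale_op: "a - b = a + (-1) *\<^sub>O b"
  by (rule blinfun_eqI, rule ell2_eqI) (simp add: blinfun.add_left blinfun.diff_left)

lemma scale_op_one [simp]: "1 *\<^sub>O a = a"
  by (rule blinfun_eqI) simp

lemma scale_op_zero_left [simp]: "0 *\<^sub>O a = 0"
  by (rule scale_op.zero_left)

lemma op_space_diff: "op_space D \<Longrightarrow> a \<in> D \<Longrightarrow> b \<in> D \<Longrightarrow> a - b \<in> D"
  by (simp add: minus_scale_op op_spaceD)

lemma op_space_closure:
  assumes "op_space D"
  shows "op_space (closure D)"
  unfolding op_space_def
proof (intro conjI ballI allI)
  show "0 \<in> closure D"
    using op_spaceD(1)[OF assms] closure_subset by blast
next
  fix a b assume "a \<in> closure D" "b \<in> closure D"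
  then obtain f g where "\<And>n. f n \<in> D" "f \<longlonglongrightarrow> a" "\<And>n. g n \<in> D" "g \<longlonglongrightarrow> b"
    unfolding closure_sequential by metis
  then show "a + b \<in> closure D"
    using op_spaceD[OF assms] tendsto_add[of f a sequentially g b]
    unfolding closure_sequential by (intro exI[of _ "\<lambda>n. f n + g n"]) auto
next
  fix c a assume "a \<in> closure D"
  then obtain f where "\<And>n. f n \<in> D" "f \<longlonglongrightarrow> a"
    unfolding closure_sequential by metis
  then show "c *\<^sub>O a \<in> closure D"
    using op_spaceD[OF assms] bounded_linear.tendsto[OF scale_op.bounded_linear_right, of f a sequentially c]
    unfolding closure_sequential by (intro exI[of _ "\<lambda>n. c *\<^sub>O f n"]) auto
qed

section \<open>Bounded functionals and the dual norm\<close>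

lemma dualD:
  assumes "\<xi> \<in> dual D"
  shows "a \<notin> D \<Longrightarrow> \<xi> a = 0"
    and "a \<in> D \<Longrightarrow> b \<in> D \<Longrightarrow> \<xi> (a + b) = \<xi> a + \<xi> b"
    and "a \<in> D \<Longrightarrow> \<xi> (c *\<^sub>O a) = c * \<xi> a"
  using assms by (auto simp: dual_def)

lemma dual_zero_arg: "op_space D \<Longrightarrow> \<xi> \<in> dual D \<Longrightarrow> \<xi> 0 = 0"
  using dualD(3)[of \<xi> D 0 0] op_spaceD(1)[of D] by simp

lemma dual_diff:
  assumes "op_space D" "\<xi> \<in> dual D" "a \<in> D" "b \<in> D"
  shows "\<xi> (a - b) = \<xi> a - \<xi> b"
  unfolding minus_scale_op using assms by (simp add: dualD op_spaceD)

lemma dualI: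
  assumes "\<And>a. a \<notin> D \<Longrightarrow> \<xi> a = 0"
    and "\<And>a b. a \<in> D \<Longrightarrow> b \<in> D \<Longrightarrow> \<xi> (a + b) = \<xi> a + \<xi> b"
    and "\<And>c a. a \<in> D \<Longrightarrow> \<xi> (c *\<^sub>O a) = c * \<xi> a"
    and "\<And>a. a \<in> D \<Longrightarrow> cmod (\<xi> a) \<le> K * norm a"
  shows "\<xi> \<in> dual D"
  using assms unfolding dual_def by blast

lemma dual_norm_bdd_above:
  assumes "\<xi> \<in> dual D"
  shows "bdd_above ((\<lambda>a. cmod (\<xi> a)) ` {a\<in>D. norm a \<le> 1})"
proof -
  obtain K where K: "\<And>a. a \<in> D \<Longrightarrow> cmod (\<xi> a) \<le> K * norm a"
    using assms unfolding dual_def by blast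
  \<comment> \<open>The constant in \<open>dual\<close> carries no sign, so its absolute value is
    taken before \<open>norm a\<close> is replaced by 1.\<close>
  have "cmod (\<xi> a) \<le> \<bar>K\<bar>" if "a \<in> D" "norm a \<le> 1" for a
  proof -
    have "K * norm a \<le> \<bar>K\<bar> * norm a" by (simp add: mult_right_mono)
    also have "\<dots> \<le> \<bar>K\<bar> * 1" by (rule mult_left_mono[OF that(2)]) simp
    finally show ?thesis using K[OF that(1)] by simp
  qed
  then show ?thesis by (intro bdd_aboveI2[where M = "\<bar>K\<bar>"]) auto
qed

lemma dual_norm_nonneg:
  assumes "op_space D" "\<xi> \<in> dual D"
  shows "0 \<le> dual_norm D \<xi>"
  unfolding dual_norm_def
  by (rule cSUP_upper2[OF dual_norm_bdd_above[OF assms(2)], of 0])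
    (use op_spaceD(1)[OF assms(1)] in auto)

lemma dual_norm_bound:
  assumes D: "op_space D" and \<xi>: "\<xi> \<in> dual D" and a: "a \<in> D"
  shows "cmod (\<xi> a) \<le> dual_norm D \<xi> * norm a"
proof (cases "a = 0")
  case True
  then show ?thesis by (simp add: dual_zero_arg[OF D \<xi>])
next
  case False
  \<comment> \<open>Rescaling \<open>a\<close> to norm 1 brings it into the set over which the
    supremum is taken.\<close>
  let ?b = "complex_of_real (inverse (norm a)) *\<^sub>O a"
  have "cmod (\<xi> ?b) \<le> dual_norm D \<xi>"
    unfolding dual_norm_def
    by (rule cSUP_upper[OF _ dual_norm_bdd_above[OF \<xi>]])
      (use False a in \<open>simp add: norm_scale_op norm_inverse op_spaceD[OF D]\<close>)
  then have "inverse (norm a) * cmod (\<xi> a) \<le> dual_norm D \<xi>"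
    by (simp only: dualD(3)[OF \<xi> a] norm_mult norm_of_real abs_inverse abs_norm_cancel)
  then show ?thesis using False by (simp add: field_simps)
qed

lemma dual_norm_le:
  assumes D: "op_space D" and "\<And>a. a \<in> D \<Longrightarrow> cmod (\<xi> a) \<le> K * norm a" and "0 \<le> K"
  shows "dual_norm D \<xi> \<le> K"
  unfolding dual_norm_def
proof (rule cSUP_least)
  show "{a\<in>D. norm a \<le> 1} \<noteq> {}"
    using op_spaceD(1)[OF D] by force
  fix a assume "a \<in> {a\<in>D. norm a \<le> 1}"
  then show "cmod (\<xi> a) \<le> K"
    using assms(2)[of a] mult_left_mono[of "norm a" 1 K] assms(3) by auto
qed

lemma tendsto_dual:
  assumes D: "op_space D" and \<xi>: "\<xi> \<in> dual D" and "f \<longlonglongrightarrow> t" and f: "\<And>n. f n \<in> D" and t: "t \<in> D"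
  shows "(\<lambda>n. \<xi> (f n)) \<longlonglongrightarrow> \<xi> t"
proof (rule LIM_zero_cancel, rule tendsto_norm_zero_cancel,
    rule tendsto_sandwich[OF _ _ tendsto_const])
  show "(\<lambda>n. dual_norm D \<xi> * norm (f n - t)) \<longlonglongrightarrow> 0"
    using assms(3) by (intro tendsto_mult_right_zero tendsto_norm_zero) (simp add: LIM_zero_iff)
  show "\<forall>\<^sub>F n in sequentially. cmod (\<xi> (f n) - \<xi> t) \<le> dual_norm D \<xi> * norm (f n - t)"
    using dual_norm_bound[OF D \<xi> op_space_diff[OF D f t]] by (simp add: dual_diff[OF D \<xi> f t])
qed simp

section \<open>The dual as a Banach space\<close>

lemma dual_zero: "(\<lambda>_. 0) \<in> dual D"
  by (rule dualI[where K = 0]) auto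

lemma dual_add:
  assumes D: "op_space D" and "\<xi> \<in> dual D" "\<eta> \<in> dual D"
  shows "(\<lambda>a. \<xi> a + \<eta> a) \<in> dual D"
proof (rule dualI)
  fix a assume a: "a \<in> D"
  show "cmod (\<xi> a + \<eta> a) \<le> (dual_norm D \<xi> + dual_norm D \<eta>) * norm a"
    using norm_triangle_ineq[of "\<xi> a" "\<eta> a"] dual_norm_bound[OF D assms(2) a]
      dual_norm_bound[OF D assms(3) a] by (simp add: distrib_right)
qed (simp_all add: dualD[OF assms(2)] dualD[OF assms(3)] algebra_simps)

lemma dual_scale:
  assumes D: "op_space D" and "\<xi> \<in> dual D"
  shows "(\<lambda>a. c * \<xi> a) \<in> dual D"
proof (rule dualI)
  fix a assume a: "a \<in> D"
  show "cmod (c * \<xi> a) \<le> (cmod c * dual_norm D \<xi>) * norm a"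
    using mult_left_mono[OF dual_norm_bound[OF D assms(2) a], of "cmod c"]
    by (simp add: norm_mult mult.assoc)
qed (simp_all add: dualD[OF assms(2)] algebra_simps)

lemma dual_diff_fun:
  assumes D: "op_space D" and "\<xi> \<in> dual D" "\<eta> \<in> dual D"
  shows "(\<lambda>a. \<xi> a - \<eta> a) \<in> dual D"
  using dual_add[OF D assms(2) dual_scale[OF D assms(3), of "-1"]] by simp

lemma dual_norm_eq_zero:
  assumes D: "op_space D" and \<xi>: "\<xi> \<in> dual D"
  shows "dual_norm D \<xi> = 0 \<longleftrightarrow> \<xi> = (\<lambda>_. 0)"
proof
  assume "dual_norm D \<xi> = 0"
  then have "\<xi> a = 0" for a
    using dual_norm_bound[OF D \<xi>, of a] dualD(1)[OF \<xi>, of a] by (cases "a \<in> D") auto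
  then show "\<xi> = (\<lambda>_. 0)" by blast
next
  assume "\<xi> = (\<lambda>_. 0)"
  then have "dual_norm D \<xi> \<le> 0"
    by (intro dual_norm_le[OF D]) auto
  then show "dual_norm D \<xi> = 0"
    using dual_norm_nonneg[OF D \<xi>] by simp
qed

lemma dual_norm_triangle:
  assumes D: "op_space D" and "\<xi> \<in> dual D" "\<eta> \<in> dual D"
  shows "dual_norm D (\<lambda>a. \<xi> a + \<eta> a) \<le> dual_norm D \<xi> + dual_norm D \<eta>"
proof (rule dual_norm_le[OF D])
  fix a assume a: "a \<in> D"
  show "cmod (\<xi> a + \<eta> a) \<le> (dual_norm D \<xi> + dual_norm D \<eta>) * norm a"
    using norm_triangle_ineq[of "\<xi> a" "\<eta> a"] dual_norm_bound[OF D assms(2) a]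
      dual_norm_bound[OF D assms(3) a] by (simp add: distrib_right)
qed (simp add: dual_norm_nonneg assms)

lemma dual_norm_scale:
  assumes D: "op_space D" and \<xi>: "\<xi> \<in> dual D"
  shows "dual_norm D (\<lambda>a. c * \<xi> a) = cmod c * dual_norm D \<xi>"
proof (rule antisym)
  have le: "dual_norm D (\<lambda>a. c * \<xi> a) \<le> cmod c * dual_norm D \<xi>" if \<xi>: "\<xi> \<in> dual D" for c \<xi>
  proof (rule dual_norm_le[OF D])
    fix a assume a: "a \<in> D"
    show "cmod (c * \<xi> a) \<le> (cmod c * dual_norm D \<xi>) * norm a"
      using mult_left_mono[OF dual_norm_bound[OF D \<xi> a], of "cmod c"]
      by (simp add: norm_mult mult.assoc)
  qed (simp add: dual_norm_nonneg D \<xi>)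
  show "dual_norm D (\<lambda>a. c * \<xi> a) \<le> cmod c * dual_norm D \<xi>"
    by (rule le[OF \<xi>])
  show "cmod c * dual_norm D \<xi> \<le> dual_norm D (\<lambda>a. c * \<xi> a)"
  proof (cases "c = 0")
    case True
    then show ?thesis
      using dual_norm_nonneg[OF D dual_zero] by simp
  next
    case False
    \<comment> \<open>The reverse inequality is the first one for the functional
      \<open>\<lambda>a. c * \<xi> a\<close> and the scalar \<open>inverse c\<close>.\<close>
    have "dual_norm D (\<lambda>a. inverse c * (c * \<xi> a)) \<le> inverse (cmod c) * dual_norm D (\<lambda>a. c * \<xi> a)"
      using le[OF dual_scale[OF D \<xi>], of "inverse c" c] by (simp only: norm_inverse)
    moreover have "(\<lambda>a. inverse c * (c * \<xi> a)) = \<xi>"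
      using False by (simp flip: mult.assoc)
    ultimately have "dual_norm D \<xi> \<le> inverse (cmod c) * dual_norm D (\<lambda>a. c * \<xi> a)"
      by (simp only:)
    then show ?thesis using False by (simp add: field_simps)
  qed
qed

text \<open>The limit is taken pointwise. All estimates have the form \<open>e * norm a\<close> with
  the index \<open>M\<close> independent of \<open>a\<close>, so they survive the limit and give
  both boundedness of \<open>f\<close> and convergence in the dual norm.\<close>

lemma dual_complete:
  assumes D: "op_space D" and F: "\<And>n::nat. F n \<in> dual D"
    and cauchy: "\<forall>e>0. \<exists>M. \<forall>k\<ge>M. \<forall>n\<ge>M. dual_norm D (\<lambda>a. F k a - F n a) < e"
  shows "\<exists>f\<in>dual D. (\<lambda>n. dual_norm D (\<lambda>a. F n a - f a)) \<longlonglongrightarrow> 0"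
proof -
  have uniform: "\<exists>M. \<forall>k\<ge>M. \<forall>n\<ge>M. \<forall>a\<in>D. cmod (F k a - F n a) \<le> e * norm a" if e: "e > 0" for e
  proof -
    obtain M where M: "\<forall>k\<ge>M. \<forall>n\<ge>M. dual_norm D (\<lambda>a. F k a - F n a) < e"
      using cauchy e by blast
    have "cmod (F k a - F n a) \<le> e * norm a" if "k \<ge> M" "n \<ge> M" "a \<in> D" for k n a
    proof -
      have "dual_norm D (\<lambda>a. F k a - F n a) * norm a \<le> e * norm a"
        using M that by (intro mult_right_mono) (auto intro: less_imp_le)
      then show ?thesis
        using dual_norm_bound[OF D dual_diff_fun[OF D F F] that(3), of k n] by linarith
    qed
    then show ?thesis by blast
  qed
  have "convergent (\<lambda>n. F n a)" for a
  proof (cases "a \<in> D")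
    case True
    have "Cauchy (\<lambda>n. F n a)"
    proof (rule CauchyI)
      fix e :: real assume "0 < e"
      \<comment> \<open>The summand 1 keeps the denominator positive when \<open>a = 0\<close> and
        makes the resulting bound strictly smaller than \<open>e\<close>.\<close>
      let ?e = "e / (norm a + 1)"
      have e: "0 < ?e"
        using \<open>0 < e\<close> by (intro divide_pos_pos) (simp_all add: add_nonneg_pos)
      have "?e * norm a < ?e * (norm a + 1)"
        by (rule mult_strict_left_mono[OF _ e]) simp
      also have "\<dots> = e"
        using norm_ge_zero[of a] by (simp add: add_nonneg_eq_0_iff)
      finally have less: "?e * norm a < e" .
      obtain M where "\<forall>k\<ge>M. \<forall>n\<ge>M. \<forall>a\<in>D. cmod (F k a - F n a) \<le> ?e * norm a"
        using uniform[OF e] by blast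
      then show "\<exists>M. \<forall>m\<ge>M. \<forall>n\<ge>M. cmod (F m a - F n a) < e"
        using True less by (intro exI[of _ M]) (meson le_less_trans)
    qed
    then show ?thesis by (simp add: Cauchy_convergent)
  qed (simp add: dualD(1)[OF F] convergent_const)
  then obtain f where f: "\<And>a. (\<lambda>n. F n a) \<longlonglongrightarrow> f a"
    unfolding convergent_def by metis
  have uniform': "\<exists>M. \<forall>n\<ge>M. \<forall>a\<in>D. cmod (F n a - f a) \<le> e * norm a" if e: "e > 0" for e
  proof -
    obtain M where M: "\<forall>k\<ge>M. \<forall>n\<ge>M. \<forall>a\<in>D. cmod (F k a - F n a) \<le> e * norm a"
      using uniform[OF e] by blast
    have "cmod (F n a - f a) \<le> e * norm a" if "n \<ge> M" "a \<in> D" for n a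
      by (rule LIMSEQ_le_const2[OF tendsto_norm[OF tendsto_diff[OF tendsto_const f]]])
        (use M that in blast)
    then show ?thesis by blast
  qed
  have "f \<in> dual D"
  proof -
    obtain M where M: "\<forall>n\<ge>M. \<forall>a\<in>D. cmod (F n a - f a) \<le> 1 * norm a"
      using uniform'[OF zero_less_one] by blast
    show ?thesis
    proof (rule dualI)
      show "f a = 0" if "a \<notin> D" for a
        by (rule LIMSEQ_unique[OF f]) (simp add: dualD(1)[OF F that])
      show "f (a + b) = f a + f b" if "a \<in> D" "b \<in> D" for a b
        using tendsto_add[OF f f, of a b]
        by (intro LIMSEQ_unique[OF f]) (simp add: dualD(2)[OF F that])
      show "f (c *\<^sub>O a) = c * f a" if "a \<in> D" for c a
        using tendsto_mult_left[OF f, of c a]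
        by (intro LIMSEQ_unique[OF f]) (simp add: dualD(3)[OF F that])
      show "cmod (f a) \<le> (dual_norm D (F M) + 1) * norm a" if "a \<in> D" for a
      proof -
        have "cmod (f a) \<le> cmod (F M a) + cmod (F M a - f a)"
          using norm_triangle_ineq4[of "F M a" "F M a - f a"] by simp
        moreover have "cmod (F M a - f a) \<le> 1 * norm a"
          using M that by blast
        ultimately show ?thesis
          using dual_norm_bound[OF D F that, of M] by (simp add: distrib_right)
      qed
    qed
  qed
  moreover have "(\<lambda>n. dual_norm D (\<lambda>a. F n a - f a)) \<longlonglongrightarrow> 0"
  proof (rule LIMSEQ_I)
    fix e :: real assume "0 < e"
    \<comment> \<open>The supremum preserves only the weak inequality, so \<open>e / 2\<close> is
      used to end strictly below \<open>e\<close>.\<close>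
    then obtain M where M: "\<forall>n\<ge>M. \<forall>a\<in>D. cmod (F n a - f a) \<le> (e / 2) * norm a"
      using uniform'[of "e / 2"] by auto
    have "norm (dual_norm D (\<lambda>a. F n a - f a) - 0) < e" if "n \<ge> M" for n
    proof -
      have "dual_norm D (\<lambda>a. F n a - f a) \<le> e / 2"
        using M that \<open>0 < e\<close> by (intro dual_norm_le[OF D]) auto
      moreover have "0 \<le> dual_norm D (\<lambda>a. F n a - f a)"
        by (rule dual_norm_nonneg[OF D dual_diff_fun[OF D F \<open>f \<in> dual D\<close>]])
      ultimately show ?thesis using \<open>0 < e\<close> by simp
    qed
    then show "\<exists>M. \<forall>n\<ge>M. norm (dual_norm D (\<lambda>a. F n a - f a) - 0) < e" by blast
  qed
  ultimately show ?thesis by blast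
qed

text \<open>The normed-space axioms and completeness hold for every dual; this isolates what remains
  to be checked for a particular product.\<close>

lemma banach_algebra_dual:
  assumes D: "op_space D"
    and "\<And>f g. f \<in> dual D \<Longrightarrow> g \<in> dual D \<Longrightarrow> m f g \<in> dual D"
    and "\<And>f g h. f \<in> dual D \<Longrightarrow> g \<in> dual D \<Longrightarrow> h \<in> dual D \<Longrightarrow> m (m f g) h = m f (m g h)"
    and "\<And>f g h. f \<in> dual D \<Longrightarrow> g \<in> dual D \<Longrightarrow> h \<in> dual D \<Longrightarrow>
      m (\<lambda>a. f a + g a) h = (\<lambda>a. m f h a + m g h a)"
    and "\<And>f g h. f \<in> dual D \<Longrightarrow> g \<in> dual D \<Longrightarrow> h \<in> dual D \<Longrightarrow>
      m h (\<lambda>a. f a + g a) = (\<lambda>a. m h f a + m h g a)"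
    and "\<And>c f g. f \<in> dual D \<Longrightarrow> g \<in> dual D \<Longrightarrow> m (\<lambda>a. c * f a) g = (\<lambda>a. c * m f g a)"
    and "\<And>c f g. f \<in> dual D \<Longrightarrow> g \<in> dual D \<Longrightarrow> m f (\<lambda>a. c * g a) = (\<lambda>a. c * m f g a)"
    and "\<And>f g. f \<in> dual D \<Longrightarrow> g \<in> dual D \<Longrightarrow>
      dual_norm D (m f g) \<le> dual_norm D f * dual_norm D g"
  shows "banach_algebra_of_functions (dual D) (dual_norm D) m"
  unfolding banach_algebra_of_functions_def
proof (intro conjI allI ballI impI)
  fix F :: "nat \<Rightarrow> ('a ell2 \<Rightarrow>\<^sub>L 'a ell2) \<Rightarrow> complex"
  assume "(\<forall>n. F n \<in> dual D) \<and>
    (\<forall>e>0. \<exists>M. \<forall>k\<ge>M. \<forall>n\<ge>M. dual_norm D (\<lambda>a. F k a - F n a) < e)"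
  then show "\<exists>f\<in>dual D. (\<lambda>n. dual_norm D (\<lambda>a. F n a - f a)) \<longlonglongrightarrow> 0"
    by (intro dual_complete[OF D]) auto
qed (auto simp: assms dual_zero intro!: dual_add dual_scale dual_norm_nonneg dual_norm_triangle
    dual_norm_scale dual_norm_eq_zero[OF D, THEN iffD1] dual_norm_eq_zero[OF D dual_zero, THEN iffD2])


section \<open>The tensor product of two functionals\<close>

lemma cstar_algebraD:
  assumes "cstar_algebra \<A>"
  shows "a \<in> \<A> \<Longrightarrow> clinear_op a" and "op_space \<A>"
    and "a \<in> \<A> \<Longrightarrow> b \<in> \<A> \<Longrightarrow> a o\<^sub>L b \<in> \<A>" and "a \<in> \<A> \<Longrightarrow> adj a \<in> \<A>" and "closed \<A>"
  using assms by (auto simp: cstar_algebra_def op_space_def)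

section \<open>The algebraic tensor product as a dense subspace of the spatial one\<close>

definition alg_tensor :: "('a ell2 \<Rightarrow>\<^sub>L 'a ell2) set \<Rightarrow> ('b ell2 \<Rightarrow>\<^sub>L 'b ell2) set
    \<Rightarrow> (('a \<times> 'b) ell2 \<Rightarrow>\<^sub>L ('a \<times> 'b) ell2) set" where
  "alg_tensor \<A> \<B> = {t. \<exists>(n::nat) a b. (\<forall>i<n. a i \<in> \<A> \<and> b i \<in> \<B>) \<and>
     t = (\<Sum>i<n. op_tensor (a i) (b i))}"

lemma min_tensor_closure: "min_tensor \<A> \<B> = closure (alg_tensor \<A> \<B>)"
  by (simp add: min_tensor_def alg_tensor_def)

lemma alg_tensor_zero: "0 \<in> alg_tensor \<A> \<B>"
  unfolding alg_tensor_def by (auto intro!: exI[of _ 0])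

lemma alg_tensor_step:
  assumes "t \<in> alg_tensor \<A> \<B>" "a \<in> \<A>" "b \<in> \<B>"
  shows "t + op_tensor a b \<in> alg_tensor \<A> \<B>"
proof -
  obtain n :: nat and f g where fg: "\<forall>i<n. f i \<in> \<A> \<and> g i \<in> \<B>" "t = (\<Sum>i<n. op_tensor (f i) (g i))"
    using assms(1) unfolding alg_tensor_def by blast
  have "t + op_tensor a b = (\<Sum>i<Suc n. op_tensor ((f(n := a)) i) ((g(n := b)) i))"
    by (simp add: fg)
  moreover have "\<forall>i<Suc n. (f(n := a)) i \<in> \<A> \<and> (g(n := b)) i \<in> \<B>"
    using fg assms by (auto simp: less_Suc_eq)
  ultimately show ?thesis unfolding alg_tensor_def by blast
qed

text \<open>Claims about the spatial tensor product are proved by adding one elementary tensor at a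
  time and then passing to the closure.\<close>

lemma alg_tensor_induct [consumes 1, case_names zero step]:
  assumes "t \<in> alg_tensor \<A> \<B>" and "P 0"
    and step: "\<And>t a b. t \<in> alg_tensor \<A> \<B> \<Longrightarrow> P t \<Longrightarrow> a \<in> \<A> \<Longrightarrow> b \<in> \<B> \<Longrightarrow> P (t + op_tensor a b)"
  shows "P t"
proof -
  have "(\<forall>i<n. f i \<in> \<A> \<and> g i \<in> \<B>) \<Longrightarrow> P (\<Sum>i<n. op_tensor (f i) (g i))" for n :: nat and f g
  proof (induction n)
    case (Suc n)
    then have "(\<Sum>i<n. op_tensor (f i) (g i)) \<in> alg_tensor \<A> \<B>"
      unfolding alg_tensor_def mem_Collect_eq
      by (intro exI[of _ n] exI[of _ f] exI[of _ g]) auto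
    with Suc show ?case by (auto intro!: step)
  qed (simp add: assms(2))
  then show ?thesis using assms(1) unfolding alg_tensor_def by blast
qed

lemma op_space_alg_tensor:
  assumes A: "cstar_algebra \<A>" and B: "cstar_algebra \<B>"
  shows "op_space (alg_tensor \<A> \<B>)"
  unfolding op_space_def
proof (intro conjI ballI allI)
  show "0 \<in> alg_tensor \<A> \<B>" by (rule alg_tensor_zero)
next
  fix t u assume "t \<in> alg_tensor \<A> \<B>" "u \<in> alg_tensor \<A> \<B>"
  from this(2,1) show "t + u \<in> alg_tensor \<A> \<B>"
    by (induction rule: alg_tensor_induct) (auto simp: alg_tensor_step simp flip: add.assoc)
next
  fix c t assume "t \<in> alg_tensor \<A> \<B>"
  then show "c *\<^sub>O t \<in> alg_tensor \<A> \<B>"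
    by (induction rule: alg_tensor_induct)
      (auto simp: alg_tensor_zero scale_op_add_right scale_op_tensor cstar_algebraD[OF A]
        cstar_algebraD[OF B] op_spaceD intro!: alg_tensor_step)
qed

lemma op_space_min_tensor:
  "cstar_algebra \<A> \<Longrightarrow> cstar_algebra \<B> \<Longrightarrow> op_space (min_tensor \<A> \<B>)"
  unfolding min_tensor_closure by (intro op_space_closure op_space_alg_tensor)

lemma op_tensor_in_alg_tensor: "a \<in> \<A> \<Longrightarrow> b \<in> \<B> \<Longrightarrow> op_tensor a b \<in> alg_tensor \<A> \<B>"
  using alg_tensor_step[OF alg_tensor_zero] by simp

lemma op_tensor_in_min_tensor: "a \<in> \<A> \<Longrightarrow> b \<in> \<B> \<Longrightarrow> op_tensor a b \<in> min_tensor \<A> \<B>"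
  unfolding min_tensor_closure using op_tensor_in_alg_tensor closure_subset by blast

lemma alg_tensor_subset: "alg_tensor \<A> \<B> \<subseteq> min_tensor \<A> \<B>"
  unfolding min_tensor_closure by (rule closure_subset)

text \<open>Complex-linear operators form a closed set that contains the algebraic tensor
  product.\<close>

lemma clinear_op_min_tensor:
  assumes A: "cstar_algebra \<A>" and B: "cstar_algebra \<B>" and t: "t \<in> min_tensor \<A> \<B>"
  shows "clinear_op t"
proof -
  have "alg_tensor \<A> \<B> \<subseteq> {t. clinear_op t}"
  proof
    fix t assume "t \<in> alg_tensor \<A> \<B>"
    then show "t \<in> {t. clinear_op t}"
      by (induction rule: alg_tensor_induct)
        (auto simp: clinear_op_add clinear_op_op_tensor cstar_algebraD[OF A] cstar_algebraD[OF B])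
  qed
  from closure_minimal[OF this closed_clinear_op] show ?thesis
    using t unfolding min_tensor_closure by blast
qed

text \<open>Additivity extends agreement to the algebraic tensor product and continuity extends it
  to the closure. This gives the uniqueness required by the definite description
  \<open>functional_tensor\<close>.\<close>

lemma dual_min_tensor_eqI:
  assumes A: "cstar_algebra \<A>" and B: "cstar_algebra \<B>"
    and \<phi>: "\<phi> \<in> dual (min_tensor \<A> \<B>)" and \<psi>: "\<psi> \<in> dual (min_tensor \<A> \<B>)"
    and eq: "\<And>a b. a \<in> \<A> \<Longrightarrow> b \<in> \<B> \<Longrightarrow> \<phi> (op_tensor a b) = \<psi> (op_tensor a b)"
  shows "\<phi> = \<psi>"
proof
  fix t
  note D = op_space_min_tensor[OF A B]
  show "\<phi> t = \<psi> t"
  proof (cases "t \<in> min_tensor \<A> \<B>")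
    case True
    have alg: "\<phi> t = \<psi> t" if "t \<in> alg_tensor \<A> \<B>" for t
      using that
    proof (induction rule: alg_tensor_induct)
      case (step t a b)
      then show ?case
        using subsetD[OF alg_tensor_subset step(1)]
        by (simp add: dualD(2)[OF \<phi>] dualD(2)[OF \<psi>] op_tensor_in_min_tensor eq)
    qed (simp add: dual_zero_arg[OF D] \<phi> \<psi>)
    obtain f where f: "\<And>n. f n \<in> alg_tensor \<A> \<B>" "f \<longlonglongrightarrow> t"
      using True unfolding min_tensor_closure closure_sequential by blast
    have f': "f n \<in> min_tensor \<A> \<B>" for n
      using f(1) alg_tensor_subset by blast
    have "(\<lambda>n. \<phi> (f n)) \<longlonglongrightarrow> \<phi> t" "(\<lambda>n. \<psi> (f n)) \<longlonglongrightarrow> \<psi> t"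
      by (rule tendsto_dual[OF D _ f(2) f' True], fact)+
    then show ?thesis
      using alg[OF f(1)] LIMSEQ_unique by auto
  qed (simp add: dualD(1)[OF \<phi>] dualD(1)[OF \<psi>])
qed

text \<open>Take \<open>y = r x\<close> and cancel one factor \<open>norm (r x)\<close>.\<close>

lemma norm_le_of_cinner:
  fixes r :: "'a ell2 \<Rightarrow>\<^sub>L 'b ell2"
  assumes "\<And>x y. cmod (cinner y (r x)) \<le> K * norm y * norm x" and "0 \<le> K"
  shows "norm r \<le> K"
proof (rule norm_blinfun_bound)
  fix x
  have "cmod (cinner (r x) (r x)) = norm (r x) * norm (r x)"
    by (simp add: cinner_self_norm norm_power power2_eq_square norm_mult)
  then have le: "norm (r x) * norm (r x) \<le> (K * norm x) * norm (r x)"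
    using assms(1)[of "r x" x] by (simp add: mult_ac)
  show "norm (r x) \<le> K * norm x"
  proof (cases "r x = 0")
    case False
    then show ?thesis using mult_right_le_imp_le[OF le] by simp
  qed (simp add: assms(2))
qed (rule assms(2))

text \<open>The operator \<open>r\<close> is (\<xi> \<otimes> id)(t), described by its matrix
  coefficients. As a relation it determines \<open>r\<close> uniquely before existence is known, and
  sums over different representations of \<open>t\<close> need no comparison.\<close>

definition is_right_slice :: "(('a ell2 \<Rightarrow>\<^sub>L 'a ell2) \<Rightarrow> complex)
    \<Rightarrow> (('a \<times> 'b) ell2 \<Rightarrow>\<^sub>L ('a \<times> 'b) ell2) \<Rightarrow> ('b ell2 \<Rightarrow>\<^sub>L 'b ell2) \<Rightarrow> bool" where
  "is_right_slice \<xi> t r \<longleftrightarrow> (\<forall>x y. cinner y (r x) = \<xi> (slice y t x))"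

lemma is_right_slice_unique: "is_right_slice \<xi> t r \<Longrightarrow> is_right_slice \<xi> t s \<Longrightarrow> r = s"
  unfolding is_right_slice_def by (intro blinfun_eqI cinner_eqI) simp

section \<open>Slicing by a functional, and products of functionals\<close>

context
  fixes \<A> :: "('a ell2 \<Rightarrow>\<^sub>L 'a ell2) set" and \<B> :: "('b ell2 \<Rightarrow>\<^sub>L 'b ell2) set"
  assumes A: "cstar_algebra \<A>" and B: "cstar_algebra \<B>"
begin

text \<open>A slice of an elementary tensor is a scalar multiple of its first factor. Continuity of
  slicing and closedness of \<open>\<A>\<close> settle the general case.\<close>

lemma slice_mem:
  assumes "t \<in> min_tensor \<A> \<B>"
  shows "slice y t x \<in> \<A>"
proof -
  have alg: "slice y t x \<in> \<A>" if "t \<in> alg_tensor \<A> \<B>" for t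
    using that
    by (induction rule: alg_tensor_induct)
      (auto simp: slice_add slice_op_tensor cstar_algebraD[OF A] cstar_algebraD[OF B] op_spaceD)
  obtain f where f: "\<And>n. f n \<in> alg_tensor \<A> \<B>" "f \<longlonglongrightarrow> t"
    using assms unfolding min_tensor_closure closure_sequential by blast
  show ?thesis
    by (rule closed_sequentially[OF cstar_algebraD(5)[OF A] _ tendsto_slice[OF f(2)]])
      (rule alg[OF f(1)])
qed

text \<open>Each matrix coefficient of \<open>r\<close> is the value of \<xi> at a slice of
  \<open>t\<close>, whose norm is controlled. This estimate lets the slice extend from the algebraic
  tensor product to its closure.\<close>

lemma norm_right_slice_le:
  assumes \<xi>: "\<xi> \<in> dual \<A>" and t: "t \<in> min_tensor \<A> \<B>" and r: "is_right_slice \<xi> t r"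
  shows "norm r \<le> dual_norm \<A> \<xi> * norm t"
proof (rule norm_le_of_cinner)
  note D = cstar_algebraD(2)[OF A]
  note nonneg = dual_norm_nonneg[OF D \<xi>]
  show "0 \<le> dual_norm \<A> \<xi> * norm t" by (simp add: nonneg)
  fix x y
  have "cmod (cinner y (r x)) \<le> dual_norm \<A> \<xi> * norm (slice y t x)"
    using r dual_norm_bound[OF D \<xi> slice_mem[OF t]] by (simp add: is_right_slice_def)
  also have "\<dots> \<le> dual_norm \<A> \<xi> * (norm y * norm t * norm x)"
    by (intro mult_left_mono norm_slice_le nonneg)
  finally show "cmod (cinner y (r x)) \<le> dual_norm \<A> \<xi> * norm t * norm y * norm x"
    by (simp add: mult_ac)
qed

lemma is_right_slice_add:
  assumes \<xi>: "\<xi> \<in> dual \<A>" and "t \<in> min_tensor \<A> \<B>" "u \<in> min_tensor \<A> \<B>"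
    and "is_right_slice \<xi> t r" "is_right_slice \<xi> u s"
  shows "is_right_slice \<xi> (t + u) (r + s)"
  using assms by (simp add: is_right_slice_def slice_add slice_mem dualD(2)[OF \<xi>]
      blinfun.add_left cinner_add_right)

lemma is_right_slice_diff:
  assumes \<xi>: "\<xi> \<in> dual \<A>" and "t \<in> min_tensor \<A> \<B>" "u \<in> min_tensor \<A> \<B>"
    and "is_right_slice \<xi> t r" "is_right_slice \<xi> u s"
  shows "is_right_slice \<xi> (t - u) (r - s)"
  using assms by (simp add: is_right_slice_def slice_diff slice_mem
      dual_diff[OF cstar_algebraD(2)[OF A] \<xi>] blinfun.diff_left cinner.diff_right)

lemma is_right_slice_scale:
  assumes \<xi>: "\<xi> \<in> dual \<A>" and "t \<in> min_tensor \<A> \<B>" and "is_right_slice \<xi> t r"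
  shows "is_right_slice \<xi> (c *\<^sub>O t) (c *\<^sub>O r)"
  using assms by (simp add: is_right_slice_def slice_scale slice_mem dualD(3)[OF \<xi>]
      cinner_scaleC_right)

lemma is_right_slice_op_tensor:
  assumes \<xi>: "\<xi> \<in> dual \<A>" and "a \<in> \<A>" "b \<in> \<B>"
  shows "is_right_slice \<xi> (op_tensor a b) (\<xi> a *\<^sub>O b)"
  using assms by (simp add: is_right_slice_def slice_op_tensor cstar_algebraD(1)[OF A]
      cstar_algebraD(1)[OF B] dualD(3)[OF \<xi>] cinner_scaleC_right mult.commute)

text \<open>For a finite sum of elementary tensors the slice is the sum of the terms
  \<open>\<xi> a *\<^sub>O b\<close>. For general \<open>t\<close>, the norm estimate applied to
  differences makes the slices of approximants Cauchy; their limit lies in the closed set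
  \<open>\<B>\<close>, and its matrix coefficients are limits of theirs.\<close>

lemma right_slice_exists:
  assumes \<xi>: "\<xi> \<in> dual \<A>" and t: "t \<in> min_tensor \<A> \<B>"
  shows "\<exists>r\<in>\<B>. is_right_slice \<xi> t r"
proof -
  note DA = cstar_algebraD(2)[OF A] and DB = cstar_algebraD(2)[OF B]
  note DT = op_space_min_tensor[OF A B]
  have alg: "\<exists>r\<in>\<B>. is_right_slice \<xi> t r" if "t \<in> alg_tensor \<A> \<B>" for t
    using that
  proof (induction rule: alg_tensor_induct)
    case zero
    show ?case
      by (intro bexI[of _ 0] op_spaceD[OF DB])
        (simp add: is_right_slice_def dual_zero_arg[OF DA \<xi>] cinner.zero_right)
  next
    case (step t a b)
    then obtain r where "r \<in> \<B>" "is_right_slice \<xi> t r" by blast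
    then show ?case
      using step subsetD[OF alg_tensor_subset step(1)]
      by (intro bexI[of _ "r + \<xi> a *\<^sub>O b"] is_right_slice_add[OF \<xi>] op_spaceD[OF DB]
          is_right_slice_op_tensor[OF \<xi>] op_tensor_in_min_tensor) auto
  qed
  obtain f where f: "\<And>n. f n \<in> alg_tensor \<A> \<B>" "f \<longlonglongrightarrow> t"
    using t unfolding min_tensor_closure closure_sequential by blast
  have f': "f n \<in> min_tensor \<A> \<B>" for n
    using f(1) alg_tensor_subset by blast
  obtain r where r: "\<And>n. r n \<in> \<B>" "\<And>n. is_right_slice \<xi> (f n) (r n)"
    using alg[OF f(1)] by metis
  let ?K = "dual_norm \<A> \<xi>"
  have le: "norm (r m - r n) \<le> ?K * norm (f m - f n)" for m n
    by (rule norm_right_slice_le[OF \<xi> op_space_diff[OF DT f' f']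
          is_right_slice_diff[OF \<xi> f' f' r(2) r(2)]])
  have "Cauchy r"
  proof (rule CauchyI)
    fix e :: real assume "0 < e"
    \<comment> \<open>The dual norm may vanish, so one divides by \<open>?K + 1\<close>
      instead.\<close>
    have pos: "0 < ?K + 1"
      using dual_norm_nonneg[OF DA \<xi>] by simp
    then have "0 < e / (?K + 1)" using \<open>0 < e\<close> by simp
    then obtain M where M: "\<forall>m\<ge>M. \<forall>n\<ge>M. norm (f m - f n) < e / (?K + 1)"
      using CauchyD[OF LIMSEQ_imp_Cauchy[OF f(2)]] by blast
    have "norm (r m - r n) < e" if "m \<ge> M" "n \<ge> M" for m n
    proof -
      have "norm (r m - r n) \<le> (?K + 1) * norm (f m - f n)"
        using le[of m n] by (simp add: distrib_right add_increasing2)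
      also have "\<dots> < (?K + 1) * (e / (?K + 1))"
        using M that by (intro mult_strict_left_mono pos) auto
      finally show ?thesis using pos by simp
    qed
    then show "\<exists>M. \<forall>m\<ge>M. \<forall>n\<ge>M. norm (r m - r n) < e" by blast
  qed
  then obtain s where s: "r \<longlonglongrightarrow> s"
    by (auto simp: Cauchy_convergent_iff convergent_def)
  have "is_right_slice \<xi> t s"
    unfolding is_right_slice_def
  proof (intro allI LIMSEQ_unique)
    fix x y
    show "(\<lambda>n. cinner y (r n x)) \<longlonglongrightarrow> cinner y (s x)"
      by (intro cinner.tendsto tendsto_const blinfun.tendsto s)
    have "(\<lambda>n. \<xi> (slice y (f n) x)) \<longlonglongrightarrow> \<xi> (slice y t x)"
      by (rule tendsto_dual[OF DA \<xi> tendsto_slice[OF f(2)] slice_mem[OF f'] slice_mem[OF t]])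
    then show "(\<lambda>n. cinner y (r n x)) \<longlonglongrightarrow> \<xi> (slice y t x)"
      using r(2) by (simp add: is_right_slice_def)
  qed
  moreover have "s \<in> \<B>"
    by (rule closed_sequentially[OF cstar_algebraD(5)[OF B] r(1) s])
  ultimately show ?thesis by blast
qed

text \<open>Slice the first tensor factor with \<xi>, then evaluate \<eta> on the resulting element
  of \<open>\<B>\<close>. The two norm bounds multiply.\<close>

lemma functional_tensor_exists:
  assumes \<xi>: "\<xi> \<in> dual \<A>" and \<eta>: "\<eta> \<in> dual \<B>"
  shows "\<exists>\<phi>\<in>dual (min_tensor \<A> \<B>). (\<forall>a\<in>\<A>. \<forall>b\<in>\<B>. \<phi> (op_tensor a b) = \<xi> a * \<eta> b) \<and>
    (\<forall>t\<in>min_tensor \<A> \<B>. cmod (\<phi> t) \<le> dual_norm \<A> \<xi> * dual_norm \<B> \<eta> * norm t)"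
proof -
  note DB = cstar_algebraD(2)[OF B] and DT = op_space_min_tensor[OF A B]
  let ?T = "min_tensor \<A> \<B>"
  obtain R where R: "\<And>t. t \<in> ?T \<Longrightarrow> R t \<in> \<B>" "\<And>t. t \<in> ?T \<Longrightarrow> is_right_slice \<xi> t (R t)"
    using right_slice_exists[OF \<xi>] by metis
  have R_eq: "R t = r" if "t \<in> ?T" "is_right_slice \<xi> t r" for t r
    using is_right_slice_unique[OF R(2)[OF that(1)] that(2)] .
  \<comment> \<open>Linearity of the chosen \<open>R\<close> follows from uniqueness of slices: sums
    and multiples of slices are slices of sums and multiples.\<close>
  have R_add: "R (t + u) = R t + R u" if "t \<in> ?T" "u \<in> ?T" for t u
    using that by (intro R_eq is_right_slice_add[OF \<xi>] R op_spaceD[OF DT])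
  have R_scale: "R (c *\<^sub>O t) = c *\<^sub>O R t" if "t \<in> ?T" for c t
    using that by (intro R_eq is_right_slice_scale[OF \<xi>] R op_spaceD[OF DT])
  \<comment> \<open>The value 0 outside the tensor product is the convention built into
    \<open>dual\<close>.\<close>
  define \<phi> where "\<phi> t = (if t \<in> ?T then \<eta> (R t) else 0)" for t
  have bound: "cmod (\<phi> t) \<le> dual_norm \<A> \<xi> * dual_norm \<B> \<eta> * norm t" if "t \<in> ?T" for t
  proof -
    have "cmod (\<phi> t) \<le> dual_norm \<B> \<eta> * norm (R t)"
      using dual_norm_bound[OF DB \<eta> R(1)[OF that]] that by (simp add: \<phi>_def)
    also have "\<dots> \<le> dual_norm \<B> \<eta> * (dual_norm \<A> \<xi> * norm t)"
      using that by (intro mult_left_mono norm_right_slice_le[OF \<xi>] R dual_norm_nonneg[OF DB \<eta>])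
    finally show ?thesis by (simp add: mult_ac)
  qed
  have "\<phi> \<in> dual ?T"
    by (rule dualI[OF _ _ _ bound])
      (simp_all add: \<phi>_def op_spaceD[OF DT] R_add R_scale R dualD[OF \<eta>])
  moreover have "\<phi> (op_tensor a b) = \<xi> a * \<eta> b" if "a \<in> \<A>" "b \<in> \<B>" for a b
    using that R_eq[OF _ is_right_slice_op_tensor[OF \<xi>]]
    by (simp add: \<phi>_def op_tensor_in_min_tensor dualD(3)[OF \<eta>])
  ultimately show ?thesis using bound by blast
qed

text \<open>Existence comes from the slice construction and uniqueness from density, so the definite
  description inherits all properties of the constructed functional, including its norm
  bound.\<close>

lemma
  assumes \<xi>: "\<xi> \<in> dual \<A>" and \<eta>: "\<eta> \<in> dual \<B>"
  shows functional_tensor_in_dual: "functional_tensor \<A> \<B> \<xi> \<eta> \<in> dual (min_tensor \<A> \<B>)"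
    and functional_tensor_op_tensor:
      "a \<in> \<A> \<Longrightarrow> b \<in> \<B> \<Longrightarrow> functional_tensor \<A> \<B> \<xi> \<eta> (op_tensor a b) = \<xi> a * \<eta> b"
    and functional_tensor_bound: "t \<in> min_tensor \<A> \<B> \<Longrightarrow>
      cmod (functional_tensor \<A> \<B> \<xi> \<eta> t) \<le> dual_norm \<A> \<xi> * dual_norm \<B> \<eta> * norm t"
proof -
  obtain \<phi> where \<phi>: "\<phi> \<in> dual (min_tensor \<A> \<B>)" "\<forall>a\<in>\<A>. \<forall>b\<in>\<B>. \<phi> (op_tensor a b) = \<xi> a * \<eta> b"
    and bound: "\<forall>t\<in>min_tensor \<A> \<B>. cmod (\<phi> t) \<le> dual_norm \<A> \<xi> * dual_norm \<B> \<eta> * norm t"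
    using functional_tensor_exists[OF assms] by blast
  have "functional_tensor \<A> \<B> \<xi> \<eta> = \<phi>"
    unfolding functional_tensor_def
  proof (rule the_equality)
    fix \<psi> assume \<psi>: "\<psi> \<in> dual (min_tensor \<A> \<B>) \<and>
      (\<forall>a\<in>\<A>. \<forall>b\<in>\<B>. \<psi> (op_tensor a b) = \<xi> a * \<eta> b)"
    show "\<psi> = \<phi>"
      by (rule dual_min_tensor_eqI[OF A B]) (use \<phi> \<psi> in auto)
  qed (use \<phi> in blast)
  then show "functional_tensor \<A> \<B> \<xi> \<eta> \<in> dual (min_tensor \<A> \<B>)"
    and "a \<in> \<A> \<Longrightarrow> b \<in> \<B> \<Longrightarrow> functional_tensor \<A> \<B> \<xi> \<eta> (op_tensor a b) = \<xi> a * \<eta> b"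
    and "t \<in> min_tensor \<A> \<B> \<Longrightarrow>
      cmod (functional_tensor \<A> \<B> \<xi> \<eta> t) \<le> dual_norm \<A> \<xi> * dual_norm \<B> \<eta> * norm t"
    using \<phi> bound by auto
qed

end


section \<open>Homomorphisms are contractive\<close>

text \<open>Continuity makes the supremum \<open>K\<close> of \<open>norm (\<Phi> x)\<close> over
  the unit ball finite. If \<open>x\<close> lies in the ball, so does
  \<open>adj x o\<^sub>L x\<close>, and the C*-inequality gives
  \<open>(norm (\<Phi> x))\<^sup>2 \<le> K\<close>. Hence \<open>K \<le> sqrt K\<close>, which
  forces \<open>K \<le> 1\<close>.\<close>

lemma star_hom_contractive:
  assumes A: "cstar_algebra \<A>" and cont: "continuous_on \<A> \<Phi>"
    and hom: "unital_star_hom \<A> \<B> \<Phi>" and B: "\<And>b. b \<in> \<B> \<Longrightarrow> clinear_op b" and a: "a \<in> \<A>"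
  shows "norm (\<Phi> a) \<le> norm a"
proof -
  note D = cstar_algebraD(2)[OF A]
  have scale: "\<Phi> (c *\<^sub>O x) = c *\<^sub>O \<Phi> x" if "x \<in> \<A>" for c x
    using hom that by (simp add: unital_star_hom_def)
  have mem: "\<Phi> x \<in> \<B>" if "x \<in> \<A>" for x
    using hom that by (simp add: unital_star_hom_def)
  have zero: "\<Phi> 0 = 0"
    using scale[OF op_spaceD(1)[OF D], of 0] by simp
  let ?U = "{x\<in>\<A>. norm x \<le> 1}"
  obtain d where d: "d > 0" "\<And>x. x \<in> \<A> \<Longrightarrow> norm x < d \<Longrightarrow> norm (\<Phi> x) < 1"
    using cont[unfolded continuous_on_iff, rule_format, OF op_spaceD(1)[OF D] zero_less_one]
    by (auto simp: zero)
  have bound: "norm (\<Phi> x) \<le> 2 / d" if x: "x \<in> ?U" for x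
  proof -
    \<comment> \<open>Continuity at 0 speaks of norms strictly below \<open>d\<close>; the factor
      \<open>d / 2\<close> moves the closed unit ball inside that range.\<close>
    let ?c = "complex_of_real (d / 2)"
    have "norm (?c *\<^sub>O x) = (d / 2) * norm x"
      using d(1) by (simp add: norm_scale_op)
    also have "\<dots> \<le> (d / 2) * 1"
      using d(1) x by (intro mult_left_mono) auto
    also have "\<dots> < d" using d(1) by simp
    finally have "norm (\<Phi> (?c *\<^sub>O x)) < 1"
      using x by (intro d(2) op_spaceD[OF D]) auto
    then show ?thesis
      using x d(1) by (simp add: scale norm_scale_op field_simps)
  qed
  define K where "K = (SUP x\<in>?U. norm (\<Phi> x))"
  have bdd: "bdd_above ((\<lambda>x. norm (\<Phi> x)) ` ?U)"
    using bound by (rule bdd_aboveI2)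
  have le_K: "norm (\<Phi> x) \<le> K" if "x \<in> ?U" for x
    unfolding K_def by (rule cSUP_upper[OF that bdd])
  have zero_U: "0 \<in> ?U" using op_spaceD(1)[OF D] by simp
  have K0: "0 \<le> K" using le_K[OF zero_U] by (simp add: zero)
  have "norm (\<Phi> x) \<le> sqrt K" if x: "x \<in> ?U" for x
  proof (rule real_le_rsqrt)
    have xA: "x \<in> \<A>" using x by simp
    have "norm (adj x o\<^sub>L x) \<le> norm (adj x) * norm x"
      by (rule norm_blinfun_compose)
    also have "\<dots> \<le> 1"
      using x by (simp add: norm_adj cstar_algebraD(1)[OF A] mult_le_one)
    finally have "adj x o\<^sub>L x \<in> ?U"
      using x by (simp add: cstar_algebraD[OF A])
    from le_K[OF this] have "norm (adj (\<Phi> x) o\<^sub>L \<Phi> x) \<le> K"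
      using hom xA by (simp add: unital_star_hom_def cstar_algebraD(4)[OF A])
    then show "(norm (\<Phi> x))\<^sup>2 \<le> K"
      using norm_blinfun_square_le[OF B[OF mem[OF xA]]] by simp
  qed
  then have "K \<le> sqrt K"
    using zero_U by (subst (1) K_def) (auto intro!: cSUP_least)
  then have "K\<^sup>2 \<le> K"
    using K0 power_mono[of K "sqrt K" 2] by simp
  then have K1: "K \<le> 1"
    using K0 by (cases "K = 0") (auto simp: power2_eq_square mult_le_cancel_left1)
  show ?thesis
  proof (cases "a = 0")
    case False
    let ?c = "complex_of_real (inverse (norm a))"
    have "norm (\<Phi> (?c *\<^sub>O a)) \<le> K"
      using False a by (intro le_K) (simp add: norm_scale_op norm_inverse op_spaceD[OF D])
    then have "inverse (norm a) * norm (\<Phi> a) \<le> 1"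
      using K1 by (simp add: scale[OF a] norm_scale_op norm_inverse)
    then show ?thesis using False by (simp add: field_simps)
  qed (simp add: zero)
qed


section \<open>The algebra generated by monomials\<close>

lemma cstar_algebra_clinear: "cstar_algebra {a. clinear_op a}"
  unfolding cstar_algebra_def
  by (simp add: clinear_op_add clinear_op_scale clinear_op_comp clinear_op_adj closed_clinear_op)

text \<open>The set of all complex-linear operators is one of the algebras being intersected. Hence
  elements of the intersection are complex-linear; the other closure properties pass to
  intersections.\<close>

lemma
  assumes "\<And>a. a \<in> X \<Longrightarrow> clinear_op a"
  shows cstar_algebra_generated: "cstar_algebra (generated_cstar_algebra X)"
    and generated_cstar_algebra_superset: "X \<subseteq> generated_cstar_algebra X"
proof -
  let ?G = "generated_cstar_algebra X"
  have all: "{a. clinear_op a} \<in> {\<A>. cstar_algebra \<A> \<and> X \<subseteq> \<A>}"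
    using assms cstar_algebra_clinear by auto
  have "closed ?G"
    unfolding generated_cstar_algebra_def by (rule closed_Inter) (simp add: cstar_algebra_def)
  moreover have "clinear_op a" if "a \<in> ?G" for a
    using that all unfolding generated_cstar_algebra_def by blast
  ultimately show "cstar_algebra ?G"
    unfolding cstar_algebra_def[of ?G]
    by (auto simp: generated_cstar_algebra_def cstar_algebraD op_spaceD[OF cstar_algebraD(2)])
  show "X \<subseteq> ?G"
    unfolding generated_cstar_algebra_def by blast
qed

section \<open>Monomials and their action on basis vectors\<close>

lemma clinear_op_isom: "clinear_op (isom S a)"
  unfolding clinear_op_def by (auto intro!: ell2_eqI simp: coord_isom)

lemma coord_adj_isom: "coord (adj (isom S a) x) g = (if g \<in> S then coord x (a + g) else 0)"
proof -
  have "coord (adj (isom S a) x) g = cinner (isom S a (ket g)) x"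
    by (subst cinner_adj[OF clinear_op_isom]) simp
  then show ?thesis by (simp add: isom_ket cinner.zero_left)
qed

lemma adj_isom_ket: "adj (isom S a) (ket b) = (if b - a \<in> S then ket (b - a) else 0)"
proof (rule ell2_eqI)
  fix g
  have "a + g = b \<longleftrightarrow> g = b - a" by (auto simp: algebra_simps)
  then show "coord (adj (isom S a) (ket b)) g = coord (if b - a \<in> S then ket (b - a) else 0) g"
    by (auto simp: coord_adj_isom)
qed

lemma clinear_op_monomial: "V \<in> monomials S \<Longrightarrow> clinear_op V"
  by (induction rule: monomials.induct) (auto simp: clinear_op_isom clinear_op_adj clinear_op_comp)

lemma adj_monomial: "V \<in> monomials S \<Longrightarrow> adj V \<in> monomials S"
  by (induction rule: monomials.induct)
    (auto simp: adj_adj clinear_op_isom adj_comp clinear_op_monomial intro: monomials.intros)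

text \<open>Both kinds of generators translate a basis vector or annihilate it, and composition
  preserves this alternative.\<close>

lemma monomial_ket:
  assumes "V \<in> monomials S"
  shows "V (ket g) = 0 \<or> (\<exists>h. V (ket g) = ket h)"
  using assms
proof (induction arbitrary: g rule: monomials.induct)
  case (mult V W)
  then show ?case
    by (metis blinfun.zero_right blinfun_apply_blinfun_compose)
qed (auto simp: isom_ket adj_isom_ket)

text \<open>This is P(S). Sums are indexed by an initial segment of the naturals, the same form in
  which the values of \<Delta> are prescribed.\<close>

definition monomial_span :: "'g::ab_group_add set \<Rightarrow> ('g ell2 \<Rightarrow>\<^sub>L 'g ell2) set" where
  "monomial_span S = {a. \<exists>(n::nat) c V. (\<forall>i<n. V i \<in> monomials S) \<and> a = (\<Sum>i<n. c i *\<^sub>O V i)}"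

lemma monomial_span_zero: "0 \<in> monomial_span S"
  unfolding monomial_span_def by (auto intro!: exI[of _ 0])

lemma sum_in_monomial_span:
  "(\<And>i. i < n \<Longrightarrow> V i \<in> monomials S) \<Longrightarrow> (\<Sum>i<n::nat. c i *\<^sub>O V i) \<in> monomial_span S"
  unfolding monomial_span_def by blast

lemma monomial_span_step:
  assumes "a \<in> monomial_span S" "W \<in> monomials S"
  shows "a + k *\<^sub>O W \<in> monomial_span S"
proof -
  obtain n :: nat and c V where V: "\<And>i. i < n \<Longrightarrow> V i \<in> monomials S" "a = (\<Sum>i<n. c i *\<^sub>O V i)"
    using assms(1) unfolding monomial_span_def by blast
  have "(\<Sum>i<Suc n. (c(n := k)) i *\<^sub>O (V(n := W)) i) \<in> monomial_span S"
    by (rule sum_in_monomial_span) (use V assms(2) in \<open>auto simp: less_Suc_eq\<close>)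
  then show ?thesis using V by simp
qed

lemma monomial_span_induct [consumes 1, case_names zero step]:
  assumes "a \<in> monomial_span S" and "P 0"
    and step: "\<And>a k W. a \<in> monomial_span S \<Longrightarrow> P a \<Longrightarrow> W \<in> monomials S \<Longrightarrow> P (a + k *\<^sub>O W)"
  shows "P a"
proof -
  obtain n :: nat and c V where V: "\<And>i. i < n \<Longrightarrow> V i \<in> monomials S" "a = (\<Sum>i<n. c i *\<^sub>O V i)"
    using assms(1) unfolding monomial_span_def by blast
  from V(1) have "P (\<Sum>i<n. c i *\<^sub>O V i)"
    by (induction n) (auto intro!: step sum_in_monomial_span assms(2))
  then show ?thesis using V(2) by simp
qed

lemma monomial_in_span: "V \<in> monomials S \<Longrightarrow> k *\<^sub>O V \<in> monomial_span S"
  using monomial_span_step[OF monomial_span_zero] by simp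

lemma op_space_monomial_span: "op_space (monomial_span S)"
  unfolding op_space_def
proof (intro conjI ballI allI)
  show "0 \<in> monomial_span S" by (rule monomial_span_zero)
next
  fix t u assume "t \<in> monomial_span S" "u \<in> monomial_span S"
  from this(2,1) show "t + u \<in> monomial_span S"
    by (induction rule: monomial_span_induct) (auto simp: monomial_span_step simp flip: add.assoc)
next
  fix c t assume "t \<in> monomial_span S"
  then show "c *\<^sub>O t \<in> monomial_span S"
    by (induction rule: monomial_span_induct)
      (auto simp: monomial_span_zero scale_op_add_right intro!: monomial_span_step)
qed

lemma clinear_op_monomial_span: "a \<in> monomial_span S \<Longrightarrow> clinear_op a"
  by (induction rule: monomial_span_induct)
    (auto simp: clinear_op_add clinear_op_scale clinear_op_monomial)

section \<open>The closure of the monomial span is the reduced algebra\<close>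

lemma comp_add_left: "(a + b) o\<^sub>L c = (a o\<^sub>L c) + (b o\<^sub>L c)"
  by (rule bounded_bilinear.add_left[OF bounded_bilinear_blinfun_compose])

lemma comp_add_right: "a o\<^sub>L (b + c) = (a o\<^sub>L b) + (a o\<^sub>L c)"
  by (rule bounded_bilinear.add_right[OF bounded_bilinear_blinfun_compose])

lemma comp_assoc: "(a o\<^sub>L b) o\<^sub>L c = a o\<^sub>L (b o\<^sub>L c)"
  by (rule blinfun_eqI) simp

lemma comp_zero_left [simp]: "0 o\<^sub>L a = 0"
  by (rule bounded_bilinear.zero_left[OF bounded_bilinear_blinfun_compose])

lemma comp_zero_right [simp]: "a o\<^sub>L 0 = 0"
  by (rule bounded_bilinear.zero_right[OF bounded_bilinear_blinfun_compose])

lemmas tendsto_comp = bounded_bilinear.tendsto[OF bounded_bilinear_blinfun_compose]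

lemma scale_op_comp: "(c *\<^sub>O a) o\<^sub>L b = c *\<^sub>O (a o\<^sub>L b)"
  by (rule blinfun_eqI) simp

lemma comp_scale_op: "clinear_op a \<Longrightarrow> a o\<^sub>L (c *\<^sub>O b) = c *\<^sub>O (a o\<^sub>L b)"
  by (rule blinfun_eqI) (simp add: clinear_opD)

lemma monomial_comp_span:
  assumes "V \<in> monomials S" "a \<in> monomial_span S"
  shows "V o\<^sub>L a \<in> monomial_span S"
  using assms(2,1)
  by (induction rule: monomial_span_induct)
    (auto simp: monomial_span_zero comp_add_right comp_scale_op clinear_op_monomial
      intro!: monomial_span_step monomials.mult)

lemma monomial_span_comp:
  assumes "a \<in> monomial_span S" "b \<in> monomial_span S"
  shows "a o\<^sub>L b \<in> monomial_span S"
  using assms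
  by (induction rule: monomial_span_induct)
    (auto simp: monomial_span_zero comp_add_left scale_op_comp monomial_comp_span
      intro!: op_spaceD[OF op_space_monomial_span])

lemma monomial_span_adj: "a \<in> monomial_span S \<Longrightarrow> adj a \<in> monomial_span S"
  by (induction rule: monomial_span_induct)
    (auto simp: monomial_span_zero adj_add adj_scale clinear_op_scale clinear_op_monomial
      clinear_op_monomial_span adj_monomial intro!: monomial_span_step)

text \<open>The span is closed under products and adjoints because monomials are; continuity of
  composition and of the adjoint carries this over to the closure.\<close>

lemma cstar_algebra_closure_span: "cstar_algebra (closure (monomial_span S))"
proof -
  let ?P = "monomial_span S"
  note D = op_space_closure[OF op_space_monomial_span, of S]
  have clin: "clinear_op a" if "a \<in> closure ?P" for a
    using closure_minimal[OF _ closed_clinear_op, of ?P] clinear_op_monomial_span that by blast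
  have "a o\<^sub>L b \<in> closure ?P" if "a \<in> closure ?P" "b \<in> closure ?P" for a b
  proof -
    obtain f g where "\<And>n. f n \<in> ?P" "f \<longlonglongrightarrow> a" "\<And>n. g n \<in> ?P" "g \<longlonglongrightarrow> b"
      using \<open>a \<in> _\<close> \<open>b \<in> _\<close> unfolding closure_sequential by metis
    then show ?thesis
      unfolding closure_sequential
      by (intro exI[of _ "\<lambda>n. f n o\<^sub>L g n"]) (auto intro!: monomial_span_comp tendsto_comp)
  qed
  moreover have "adj a \<in> closure ?P" if a: "a \<in> closure ?P" for a
  proof -
    obtain f where f: "\<And>n. f n \<in> ?P" "f \<longlonglongrightarrow> a"
      using a unfolding closure_sequential by metis
    have "(\<lambda>n. adj (f n)) \<longlonglongrightarrow> adj a"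
      by (rule tendsto_adj[OF f(2) clinear_op_monomial_span[OF f(1)] clin[OF a]])
    then show ?thesis
      unfolding closure_sequential using f(1)
      by (intro exI[of _ "\<lambda>n. adj (f n)"]) (auto intro!: monomial_span_adj)
  qed
  ultimately show ?thesis
    using clin op_spaceD[OF D] unfolding cstar_algebra_def by simp
qed

lemma cstar_algebra_red: "cstar_algebra (cstar_red S)"
  unfolding cstar_red_def by (rule cstar_algebra_generated) (auto simp: clinear_op_isom)

lemma monomial_in_red: "V \<in> monomials S \<Longrightarrow> V \<in> cstar_red S"
proof (induction rule: monomials.induct)
  case (isom a)
  then show ?case
    unfolding cstar_red_def
    by (intro subsetD[OF generated_cstar_algebra_superset]) (auto simp: clinear_op_isom)
next
  case (adj_isom b)
  then have "isom S b \<in> cstar_red S"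
    unfolding cstar_red_def
    by (intro subsetD[OF generated_cstar_algebra_superset]) (auto simp: clinear_op_isom)
  then show ?case by (rule cstar_algebraD(4)[OF cstar_algebra_red])
qed (rule cstar_algebraD(3)[OF cstar_algebra_red])

text \<open>The closure is a C*-algebra containing the generators, hence contains the generated one;
  conversely, the generated algebra is closed and contains every monomial.\<close>

lemma cstar_red_closure: "cstar_red S = closure (monomial_span S)"
proof
  have "isom S ` S \<subseteq> closure (monomial_span S)"
    using monomial_in_span[OF monomials.isom, of _ S 1] closure_subset[of "monomial_span S"] by auto
  then show "cstar_red S \<subseteq> closure (monomial_span S)"
    unfolding cstar_red_def generated_cstar_algebra_def
    using cstar_algebra_closure_span[of S] by blast
  have "monomial_span S \<subseteq> cstar_red S"
  proof
    fix a assume "a \<in> monomial_span S"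
    then show "a \<in> cstar_red S"
      by (induction rule: monomial_span_induct)
        (auto simp: monomial_in_red op_spaceD[OF cstar_algebraD(2)[OF cstar_algebra_red]])
  qed
  then show "closure (monomial_span S) \<subseteq> cstar_red S"
    by (rule closure_minimal) (rule cstar_algebraD(5)[OF cstar_algebra_red])
qed

lemma monomial_span_subset: "monomial_span S \<subseteq> cstar_red S"
  unfolding cstar_red_closure by (rule closure_subset)

lemma cstar_red_approx:
  assumes "a \<in> cstar_red S"
  shows "\<exists>f. (\<forall>n. f n \<in> monomial_span S) \<and> (\<forall>n. f n \<in> cstar_red S) \<and> f \<longlonglongrightarrow> a"
proof -
  obtain f where "\<forall>n. f n \<in> monomial_span S" "f \<longlonglongrightarrow> a"
    using assms unfolding cstar_red_closure closure_sequential by blast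
  then show ?thesis
    using monomial_span_subset[THEN subsetD] by (intro exI[of _ f] conjI allI) auto
qed

text \<open>By linearity and density, identities between bounded functionals reduce to identities
  between numbers, one for each monomial.\<close>

lemma dual_red_eqI:
  assumes \<xi>: "\<xi> \<in> dual (cstar_red S)" and \<eta>: "\<eta> \<in> dual (cstar_red S)"
    and eq: "\<And>V. V \<in> monomials S \<Longrightarrow> \<xi> V = \<eta> V"
  shows "\<xi> = \<eta>"
proof
  fix a
  note D = cstar_algebraD(2)[OF cstar_algebra_red, of S]
  have span: "\<xi> a = \<eta> a" if "a \<in> monomial_span S" for a
    using that
  proof (induction rule: monomial_span_induct)
    case (step a k W)
    then show ?case
      using subsetD[OF monomial_span_subset step(1)]
      by (simp add: dualD(2,3)[OF \<xi>] dualD(2,3)[OF \<eta>] monomial_in_red op_spaceD[OF D] eq)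
  qed (simp add: dual_zero_arg[OF D] \<xi> \<eta>)
  show "\<xi> a = \<eta> a"
  proof (cases "a \<in> cstar_red S")
    case True
    then obtain f where f: "\<And>n. f n \<in> monomial_span S" "\<And>n. f n \<in> cstar_red S" "f \<longlonglongrightarrow> a"
      using cstar_red_approx by blast
    have "(\<lambda>n. \<xi> (f n)) \<longlonglongrightarrow> \<xi> a" "(\<lambda>n. \<eta> (f n)) \<longlonglongrightarrow> \<eta> a"
      by (rule tendsto_dual[OF D _ f(3) f(2) True], fact)+
    then show ?thesis
      using span[OF f(1)] LIMSEQ_unique by auto
  qed (simp add: dualD(1)[OF \<xi>] dualD(1)[OF \<eta>])
qed

section \<open>Units of the reduced algebra and of tensor products\<close>

lemma adj_isom_zero: "adj (isom S 0) = isom S 0"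
  by (rule blinfun_eqI, rule ell2_eqI) (simp add: coord_adj_isom coord_isom)

text \<open>On \<open>l^2\<close> of the whole group, \<open>isom S 0\<close> is the orthogonal
  projection onto \<open>l^2(S)\<close>. Every generator vanishes on the complement of that subspace
  and has range inside it.\<close>

lemma isom_zero_unit:
  assumes zero: "0 \<in> S" and add: "\<And>a b. a \<in> S \<Longrightarrow> b \<in> S \<Longrightarrow> a + b \<in> S"
  shows "is_unit_of (cstar_red S) (isom S 0)"
proof -
  let ?u = "isom S 0"
  have isom: "?u o\<^sub>L isom S a = isom S a" "isom S a o\<^sub>L ?u = isom S a" if "a \<in> S" for a
  proof -
    \<comment> \<open>If \<open>g - a\<close> were in \<open>S\<close>, then so would be
      \<open>g = (g - a) + a\<close>.\<close>
    have "coord (isom S a x) g = 0" if "g \<notin> S" for x g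
      using add[of "g - a" a] \<open>a \<in> S\<close> that by (auto simp: coord_isom)
    then show "?u o\<^sub>L isom S a = isom S a"
      by (intro blinfun_eqI ell2_eqI) (simp add: coord_isom[of S 0])
    show "isom S a o\<^sub>L ?u = isom S a"
      by (intro blinfun_eqI ell2_eqI) (simp add: coord_isom)
  qed
  have monomial: "?u o\<^sub>L V = V \<and> V o\<^sub>L ?u = V" if "V \<in> monomials S" for V
    using that
  proof (induction rule: monomials.induct)
    case (adj_isom b)
    \<comment> \<open>Since \<open>?u\<close> is self-adjoint, taking adjoints exchanges the left
      and right unit laws of \<open>isom S b\<close>.\<close>
    have "adj (isom S b o\<^sub>L ?u) = adj (isom S b)" "adj (?u o\<^sub>L isom S b) = adj (isom S b)"
      using isom[OF adj_isom] by simp_all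
    then show ?case by (simp add: adj_comp clinear_op_isom adj_isom_zero)
  next
    case (mult V W)
    then show ?case by (metis comp_assoc)
  qed (simp add: isom)
  have clin: "clinear_op ?u" by (rule clinear_op_isom)
  have span: "?u o\<^sub>L a = a \<and> a o\<^sub>L ?u = a" if "a \<in> monomial_span S" for a
    using that
    by (induction rule: monomial_span_induct)
      (auto simp: comp_add_left comp_add_right scale_op_comp comp_scale_op clin monomial)
  have "?u o\<^sub>L a = a \<and> a o\<^sub>L ?u = a" if a: "a \<in> cstar_red S" for a
  proof -
    obtain f where f: "\<And>n. f n \<in> monomial_span S" "f \<longlonglongrightarrow> a"
      using cstar_red_approx[OF a] by blast
    have "(\<lambda>n. ?u o\<^sub>L f n) \<longlonglongrightarrow> (?u o\<^sub>L a)" "(\<lambda>n. f n o\<^sub>L ?u) \<longlonglongrightarrow> (a o\<^sub>L ?u)"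
      by (intro tendsto_comp tendsto_const f)+
    then show ?thesis using span[OF f(1)] f(2) LIMSEQ_unique by auto
  qed
  then show ?thesis
    unfolding is_unit_of_def using monomial_in_red[OF monomials.isom[OF zero]] by blast
qed

lemma is_unit_of_unique: "is_unit_of \<A> u \<Longrightarrow> is_unit_of \<A> v \<Longrightarrow> u = v"
  unfolding is_unit_of_def by metis

lemma op_tensor_unit:
  assumes "is_unit_of \<A> u" "is_unit_of \<B> v" and A: "cstar_algebra \<A>" and B: "cstar_algebra \<B>"
  shows "is_unit_of (min_tensor \<A> \<B>) (op_tensor u v)"
proof -
  let ?w = "op_tensor u v"
  have uv: "u \<in> \<A>" "v \<in> \<B>" using assms by (auto simp: is_unit_of_def)
  have alg: "?w o\<^sub>L t = t \<and> t o\<^sub>L ?w = t" if "t \<in> alg_tensor \<A> \<B>" for t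
    using that
  proof (induction rule: alg_tensor_induct)
    case (step t a b)
    then show ?case
      using assms uv by (simp add: comp_add_left comp_add_right op_tensor_comp cstar_algebraD(1)[OF A]
          cstar_algebraD(1)[OF B] is_unit_of_def)
  qed simp
  have "?w o\<^sub>L t = t \<and> t o\<^sub>L ?w = t" if t: "t \<in> min_tensor \<A> \<B>" for t
  proof -
    obtain f where f: "\<And>n. f n \<in> alg_tensor \<A> \<B>" "f \<longlonglongrightarrow> t"
      using t unfolding min_tensor_closure closure_sequential by blast
    have "(\<lambda>n. ?w o\<^sub>L f n) \<longlonglongrightarrow> (?w o\<^sub>L t)" "(\<lambda>n. f n o\<^sub>L ?w) \<longlonglongrightarrow> (t o\<^sub>L ?w)"
      by (intro tendsto_comp tendsto_const f)+
    then show ?thesis using alg[OF f(1)] f(2) LIMSEQ_unique by auto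
  qed
  then show ?thesis
    unfolding is_unit_of_def using uv op_tensor_in_min_tensor by blast
qed


section \<open>The comultiplication\<close>

text \<open>Place the coordinates of \<open>x\<close> on the diagonal and 0 elsewhere. Each row then
  has at most one nonzero entry, so the norm is preserved, and reading off the diagonal recovers
  \<open>x\<close>.\<close>

lemma diagonal_exists:
  "\<exists>J :: 'a ell2 \<Rightarrow>\<^sub>L ('a \<times> 'a) ell2. clinear_op J \<and> (\<forall>i. J (ket i) = ket (i, i)) \<and> inj (blinfun_apply J)"
proof -
  let ?f = "\<lambda>(x :: 'a ell2) (i, j). if i = j then coord x i else 0"
  define J where "J x = Abs_ell2 (?f x)" for x
  have has_sum: "((\<lambda>j. (cmod (?f x (i, j)))\<^sup>2) has_sum (cmod (coord x i))\<^sup>2) UNIV" for x i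
    by (rule has_sum_finite_neutralI[of "{i}"]) auto
  have J: "coord (J x) = ?f x" for x
    unfolding J_def
    by (rule coord_Abs_ell2[OF square_summable_pair(1)[OF has_sum coord_square_summable]])
  have "norm (J x) = norm x" for x
  proof -
    have "(norm (J x))\<^sup>2 = (norm x)\<^sup>2"
      unfolding norm_ell2_square[of "J x"] norm_ell2_square[of x] J
      by (rule square_summable_pair(2)[OF has_sum coord_square_summable])
    then show ?thesis by simp
  qed
  then have "bounded_linear J"
    by (intro bounded_linear_intro[where K = 1] ell2_eqI) (auto simp: J)
  then have app: "blinfun_apply (Blinfun J) = J"
    by (rule bounded_linear_Blinfun_apply)
  have "inj J"
  proof (rule injI, rule ell2_eqI)
    fix x y i assume "J x = J y"
    then have "coord (J x) (i, i) = coord (J y) (i, i)" by simp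
    then show "coord x i = coord y i" by (simp add: J)
  qed
  moreover have "J (ket i) = ket (i, i)" for i
    by (rule ell2_eqI) (auto simp: J split: if_splits)
  moreover have "J (c *\<^sub>C x) = c *\<^sub>C J x" for c x
    by (rule ell2_eqI) (auto simp: J)
  ultimately show ?thesis
    by (intro exI[of _ "Blinfun J"]) (simp add: app clinear_op_def)
qed

text \<open>If \<open>V\<close> sends \<open>ket g\<close> to \<open>ket h\<close>, both sides send
  it to \<open>ket (h, h)\<close>; if \<open>V\<close> annihilates \<open>ket g\<close>, both sides
  give 0. By \<open>monomial_ket\<close> no other case occurs.\<close>

lemma monomial_diagonal:
  fixes J :: "'g::ab_group_add ell2 \<Rightarrow>\<^sub>L ('g \<times> 'g) ell2"
  assumes V: "V \<in> monomials S" and J: "clinear_op J" "\<And>i. J (ket i) = ket (i, i)"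
  shows "op_tensor V V o\<^sub>L J = J o\<^sub>L V"
proof (rule blinfun_eqI_ket)
  fix c g
  note lin = clinear_op_monomial[OF V]
  have "op_tensor V V (ket (g, g)) = J (V (ket g))"
    using monomial_ket[OF V, of g]
    by (auto simp: ket_pair op_tensor_apply lin vec_tensor.zero_left J(2))
  then show "(op_tensor V V o\<^sub>L J) (c *\<^sub>C ket g) = (J o\<^sub>L V) (c *\<^sub>C ket g)"
    by (simp add: J(2) clinear_opD[OF J(1)] clinear_opD[OF lin]
        clinear_opD[OF clinear_op_op_tensor[OF lin lin]])
qed

section \<open>The map \<Delta> on linear combinations of monomials\<close>

context
  fixes S :: "'g::ab_group_add set"
    and \<Delta> :: "('g ell2 \<Rightarrow>\<^sub>L 'g ell2) \<Rightarrow> (('g \<times> 'g) ell2 \<Rightarrow>\<^sub>L ('g \<times> 'g) ell2)"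
  assumes zero_in_S: "0 \<in> S"
    and add_in_S: "\<And>a b. a \<in> S \<Longrightarrow> b \<in> S \<Longrightarrow> a + b \<in> S"
    and continuous: "continuous_on (cstar_red S) \<Delta>"
    and on_polynomials: "\<And>(n::nat) (c::nat \<Rightarrow> complex) V. (\<And>i. i < n \<Longrightarrow> V i \<in> monomials S) \<Longrightarrow>
      \<Delta> (\<Sum>i<n. c i *\<^sub>O V i) = (\<Sum>i<n. c i *\<^sub>O op_tensor (V i) (V i))"
begin

text \<open>Appending \<open>k *\<^sub>O W\<close> at index \<open>n\<close> gives a sum to which
  the formula for \<Delta> applies again. This is the inductive step behind the algebraic laws of
  \<Delta> on the span.\<close>

lemma comult_step:
  assumes "a \<in> monomial_span S" "W \<in> monomials S"
  shows "\<Delta> (a + k *\<^sub>O W) = \<Delta> a + k *\<^sub>O op_tensor W W"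
proof -
  obtain n :: nat and c V where V: "\<And>i. i < n \<Longrightarrow> V i \<in> monomials S" "a = (\<Sum>i<n. c i *\<^sub>O V i)"
    using assms(1) unfolding monomial_span_def by blast
  have "\<Delta> (\<Sum>i<Suc n. (c(n := k)) i *\<^sub>O (V(n := W)) i)
      = (\<Sum>i<Suc n. (c(n := k)) i *\<^sub>O op_tensor ((V(n := W)) i) ((V(n := W)) i))"
    by (rule on_polynomials) (use V assms(2) in \<open>auto simp: less_Suc_eq\<close>)
  then show ?thesis
    using V on_polynomials[of n V c] by simp
qed

lemma comult_zero: "\<Delta> 0 = 0"
  using on_polynomials[of 0] by simp

lemma comult_monomial: "W \<in> monomials S \<Longrightarrow> \<Delta> W = op_tensor W W"
  using comult_step[OF monomial_span_zero, of W 1] by (simp add: comult_zero)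

lemma comult_span_add:
  assumes "a \<in> monomial_span S" "b \<in> monomial_span S"
  shows "\<Delta> (a + b) = \<Delta> a + \<Delta> b"
  using assms(2,1)
proof (induction rule: monomial_span_induct)
  case (step b k W)
  then have "a + b \<in> monomial_span S"
    by (intro op_spaceD[OF op_space_monomial_span])
  with step show ?case
    by (simp add: comult_step flip: add.assoc)
qed (simp add: comult_zero)

lemma comult_span_scale: "a \<in> monomial_span S \<Longrightarrow> \<Delta> (c *\<^sub>O a) = c *\<^sub>O \<Delta> a"
  by (induction rule: monomial_span_induct)
    (simp_all add: comult_zero scale_op_add_right comult_step op_spaceD[OF op_space_monomial_span])

text \<open>The basic identity is (V \<otimes> V)(W \<otimes> W) = VW \<otimes> VW, where VW is
  again a monomial. Multiplicativity is obtained first for a monomial on the left, then by induction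
  on the left factor.\<close>

lemma comult_monomial_comp:
  assumes V: "V \<in> monomials S" and "a \<in> monomial_span S"
  shows "\<Delta> (V o\<^sub>L a) = op_tensor V V o\<^sub>L \<Delta> a"
  using assms(2)
proof (induction rule: monomial_span_induct)
  case (step a k W)
  have "\<Delta> (V o\<^sub>L (a + k *\<^sub>O W)) = \<Delta> (V o\<^sub>L a) + k *\<^sub>O op_tensor (V o\<^sub>L W) (V o\<^sub>L W)"
    using V step by (simp add: comp_add_right comp_scale_op clinear_op_monomial comult_step
        monomial_comp_span monomials.mult)
  also have "\<dots> = (op_tensor V V o\<^sub>L \<Delta> a) + k *\<^sub>O (op_tensor V V o\<^sub>L op_tensor W W)"
    using V step by (simp add: op_tensor_comp clinear_op_monomial)
  also have "\<dots> = op_tensor V V o\<^sub>L \<Delta> (a + k *\<^sub>O W)"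
    using V step by (simp add: comult_step comp_add_right comp_scale_op clinear_op_op_tensor
        clinear_op_monomial)
  finally show ?case .
qed (simp add: comult_zero)

lemma comult_span_comp:
  assumes "a \<in> monomial_span S" "b \<in> monomial_span S"
  shows "\<Delta> (a o\<^sub>L b) = \<Delta> a o\<^sub>L \<Delta> b"
  using assms
proof (induction rule: monomial_span_induct)
  case (step a k W)
  have "\<Delta> ((a + k *\<^sub>O W) o\<^sub>L b) = \<Delta> (a o\<^sub>L b) + \<Delta> (k *\<^sub>O (W o\<^sub>L b))"
    using step by (simp add: comp_add_left scale_op_comp comult_span_add monomial_span_comp
        monomial_comp_span op_spaceD[OF op_space_monomial_span])
  also have "\<dots> = \<Delta> (a + k *\<^sub>O W) o\<^sub>L \<Delta> b"
    using step by (simp add: comult_span_scale comult_monomial_comp monomial_comp_span comult_step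
        comp_add_left scale_op_comp)
  finally show ?case .
qed (simp add: comult_zero)

lemma comult_span_in_alg_tensor:
  "a \<in> monomial_span S \<Longrightarrow> \<Delta> a \<in> alg_tensor (cstar_red S) (cstar_red S)"
proof (induction rule: monomial_span_induct)
  case (step a k W)
  note D = op_space_alg_tensor[OF cstar_algebra_red[of S] cstar_algebra_red[of S]]
  from step show ?case
    by (simp add: comult_step monomial_in_red op_tensor_in_alg_tensor op_spaceD[OF D])
qed (simp add: comult_zero alg_tensor_zero)

lemma comult_span_adj: "a \<in> monomial_span S \<Longrightarrow> \<Delta> (adj a) = adj (\<Delta> a)"
proof (induction rule: monomial_span_induct)
  case (step a k W)
  \<comment> \<open>Additivity of \<open>adj\<close> is available for complex-linear operators, so
    this is secured for the partial sum first.\<close>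
  have "clinear_op (\<Delta> a)"
    using clinear_op_min_tensor[OF cstar_algebra_red cstar_algebra_red]
      comult_span_in_alg_tensor[OF step(1)] alg_tensor_subset by blast
  with step show ?case
    by (simp add: adj_add adj_scale clinear_op_scale clinear_op_monomial clinear_op_monomial_span
        comult_step monomial_span_adj adj_monomial clinear_op_op_tensor adj_op_tensor)
qed (simp add: comult_zero)

section \<open>Extension to the reduced algebra by continuity, and injectivity\<close>

lemma tendsto_comult:
  assumes "f \<longlonglongrightarrow> a" "\<And>n. f n \<in> cstar_red S" "a \<in> cstar_red S"
  shows "(\<lambda>n. \<Delta> (f n)) \<longlonglongrightarrow> \<Delta> a"
  by (rule continuous_on_tendsto_compose[OF continuous assms(1,3)]) (simp add: assms(2))

lemma comult_in_min_tensor: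
  assumes "a \<in> cstar_red S"
  shows "\<Delta> a \<in> min_tensor (cstar_red S) (cstar_red S)"
proof -
  obtain f where f: "\<And>n. f n \<in> monomial_span S" "\<And>n. f n \<in> cstar_red S" "f \<longlonglongrightarrow> a"
    using cstar_red_approx[OF assms] by blast
  show ?thesis
    unfolding min_tensor_closure closure_sequential
    using comult_span_in_alg_tensor[OF f(1)] tendsto_comult[OF f(3,2) assms]
    by (intro exI[of _ "\<lambda>n. \<Delta> (f n)"]) blast
qed

text \<open>Each law holds along sequences of approximants from the span. Continuity of \<Delta>, of
  the operations and of the adjoint carries both sides to the limit.\<close>

lemma comult_hom: "unital_star_hom (cstar_red S) (min_tensor (cstar_red S) (cstar_red S)) \<Delta>"
  unfolding unital_star_hom_def
proof (intro conjI ballI allI impI)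
  let ?A = "cstar_red S"
  note A = cstar_algebra_red[of S]
  note D = cstar_algebraD[OF A] op_spaceD[OF cstar_algebraD(2)[OF A]]
  show "\<Delta> a \<in> min_tensor ?A ?A" if "a \<in> ?A" for a
    by (rule comult_in_min_tensor[OF that])
  fix a assume a: "a \<in> ?A"
  obtain f where f: "\<And>n. f n \<in> monomial_span S" "\<And>n. f n \<in> ?A" "f \<longlonglongrightarrow> a"
    using cstar_red_approx[OF a] by blast
  note lim = tendsto_comult[OF f(3,2) a]
  {
    fix b assume b: "b \<in> ?A"
    obtain g where g: "\<And>n. g n \<in> monomial_span S" "\<And>n. g n \<in> ?A" "g \<longlonglongrightarrow> b"
      using cstar_red_approx[OF b] by blast
    note lim' = tendsto_comult[OF g(3,2) b]
    have "(\<lambda>n. \<Delta> (f n + g n)) \<longlonglongrightarrow> \<Delta> (a + b)"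
      by (intro tendsto_comult tendsto_add f g D a b)
    then show "\<Delta> (a + b) = \<Delta> a + \<Delta> b"
      using tendsto_add[OF lim lim'] LIMSEQ_unique by (simp add: comult_span_add[OF f(1) g(1)])
    have "(\<lambda>n. \<Delta> (f n o\<^sub>L g n)) \<longlonglongrightarrow> \<Delta> (a o\<^sub>L b)"
      by (intro tendsto_comult tendsto_comp f g D a b)
    then show "\<Delta> (a o\<^sub>L b) = \<Delta> a o\<^sub>L \<Delta> b"
      using tendsto_comp[OF lim lim'] LIMSEQ_unique by (simp add: comult_span_comp[OF f(1) g(1)])
  }
  note tendsto_scale = bounded_linear.tendsto[OF scale_op.bounded_linear_right]
  show "\<Delta> (c *\<^sub>O a) = c *\<^sub>O \<Delta> a" for c
  proof -
    have "(\<lambda>n. \<Delta> (c *\<^sub>O f n)) \<longlonglongrightarrow> \<Delta> (c *\<^sub>O a)"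
      by (intro tendsto_comult tendsto_scale f D a)
    then show ?thesis
      using tendsto_scale[OF lim, of c] LIMSEQ_unique by (simp add: comult_span_scale[OF f(1)])
  qed
  have "(\<lambda>n. \<Delta> (adj (f n))) \<longlonglongrightarrow> \<Delta> (adj a)"
    by (intro tendsto_comult tendsto_adj f D a)
  moreover have "(\<lambda>n. adj (\<Delta> (f n))) \<longlonglongrightarrow> adj (\<Delta> a)"
    by (intro tendsto_adj lim clinear_op_min_tensor[OF A A]
        comult_in_min_tensor f a)
  ultimately show "\<Delta> (adj a) = adj (\<Delta> a)"
    using LIMSEQ_unique by (simp add: comult_span_adj[OF f(1)])
next
  fix u assume "is_unit_of (cstar_red S) u"
  \<comment> \<open>The unit is unique, hence it is the monomial \<open>isom S 0\<close>, whose
    image is its tensor square.\<close>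
  then have u: "u = isom S 0"
    using is_unit_of_unique isom_zero_unit[OF zero_in_S add_in_S] by blast
  show "is_unit_of (min_tensor (cstar_red S) (cstar_red S)) (\<Delta> u)"
    unfolding u comult_monomial[OF monomials.isom[OF zero_in_S]]
    by (intro op_tensor_unit isom_zero_unit zero_in_S add_in_S cstar_algebra_red)
qed

text \<open>The intertwining relation with the diagonal isometry recovers
  \<open>J o\<^sub>L a\<close> from \<Delta>(a), and \<open>J\<close> can be cancelled because it is
  injective.\<close>

lemma comult_inj: "inj_on \<Delta> (cstar_red S)"
proof -
  obtain J :: "'g ell2 \<Rightarrow>\<^sub>L ('g \<times> 'g) ell2"
    where J: "clinear_op J" "\<And>i. J (ket i) = ket (i, i)" and inj: "inj (blinfun_apply J)"
    using diagonal_exists by blast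
  have span: "\<Delta> a o\<^sub>L J = J o\<^sub>L a" if "a \<in> monomial_span S" for a
    using that
    by (induction rule: monomial_span_induct)
      (simp_all add: comult_zero comult_step comp_add_left comp_add_right scale_op_comp
        comp_scale_op J(1) monomial_diagonal[OF _ J])
  have "\<Delta> a o\<^sub>L J = J o\<^sub>L a" if a: "a \<in> cstar_red S" for a
  proof -
    obtain f where f: "\<And>n. f n \<in> monomial_span S" "\<And>n. f n \<in> cstar_red S" "f \<longlonglongrightarrow> a"
      using cstar_red_approx[OF a] by blast
    have "(\<lambda>n. \<Delta> (f n) o\<^sub>L J) \<longlonglongrightarrow> (\<Delta> a o\<^sub>L J)"
      by (intro tendsto_comp tendsto_const tendsto_comult f a)
    moreover have "(\<lambda>n. J o\<^sub>L f n) \<longlonglongrightarrow> (J o\<^sub>L a)"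
      by (intro tendsto_comp tendsto_const f)
    ultimately show ?thesis
      using LIMSEQ_unique by (simp add: span[OF f(1)])
  qed
  then have "J o\<^sub>L a = J o\<^sub>L b" if "a \<in> cstar_red S" "b \<in> cstar_red S" "\<Delta> a = \<Delta> b" for a b
    using that by metis
  then show ?thesis
    by (intro inj_onI blinfun_eqI injD[OF inj]) (metis blinfun_apply_blinfun_compose)
qed

lemma comult_contractive: "a \<in> cstar_red S \<Longrightarrow> norm (\<Delta> a) \<le> norm a"
  by (rule star_hom_contractive[OF cstar_algebra_red continuous comult_hom])
    (rule clinear_op_min_tensor[OF cstar_algebra_red cstar_algebra_red])

section \<open>The convolution product on the dual space\<close>

lemma convolution_bound:
  assumes "\<xi> \<in> dual (cstar_red S)" "\<eta> \<in> dual (cstar_red S)" "a \<in> cstar_red S"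
  shows "cmod (convolution (cstar_red S) \<Delta> \<xi> \<eta> a)
    \<le> dual_norm (cstar_red S) \<xi> * dual_norm (cstar_red S) \<eta> * norm a"
proof -
  let ?A = "cstar_red S"
  note A = cstar_algebra_red[of S]
  have "cmod (convolution ?A \<Delta> \<xi> \<eta> a) \<le> dual_norm ?A \<xi> * dual_norm ?A \<eta> * norm (\<Delta> a)"
    using functional_tensor_bound[OF A A assms(1,2) comult_in_min_tensor[OF assms(3)]] assms(3)
    by (simp add: convolution_def)
  also have "\<dots> \<le> dual_norm ?A \<xi> * dual_norm ?A \<eta> * norm a"
    by (intro mult_left_mono comult_contractive mult_nonneg_nonneg dual_norm_nonneg assms
        cstar_algebraD(2)[OF A])
  finally show ?thesis .
qed

lemma convolution_in_dual:
  assumes "\<xi> \<in> dual (cstar_red S)" "\<eta> \<in> dual (cstar_red S)"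
  shows "convolution (cstar_red S) \<Delta> \<xi> \<eta> \<in> dual (cstar_red S)"
proof (rule dualI[OF _ _ _ convolution_bound[OF assms]])
  note A = cstar_algebra_red[of S]
  note D = op_spaceD[OF cstar_algebraD(2)[OF A]]
  note ft = functional_tensor_in_dual[OF A A assms]
  fix a b c
  show "convolution (cstar_red S) \<Delta> \<xi> \<eta> a = 0" if "a \<notin> cstar_red S"
    using that by (simp add: convolution_def)
  assume a: "a \<in> cstar_red S"
  have "\<Delta> (c *\<^sub>O a) = c *\<^sub>O \<Delta> a"
    using comult_hom a by (simp add: unital_star_hom_def)
  then show "convolution (cstar_red S) \<Delta> \<xi> \<eta> (c *\<^sub>O a) = c * convolution (cstar_red S) \<Delta> \<xi> \<eta> a"
    using a by (simp add: convolution_def D dualD(3)[OF ft] comult_in_min_tensor)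
  assume b: "b \<in> cstar_red S"
  have "\<Delta> (a + b) = \<Delta> a + \<Delta> b"
    using comult_hom a b by (simp add: unital_star_hom_def)
  then show "convolution (cstar_red S) \<Delta> \<xi> \<eta> (a + b)
      = convolution (cstar_red S) \<Delta> \<xi> \<eta> a + convolution (cstar_red S) \<Delta> \<xi> \<eta> b"
    using a b by (simp add: convolution_def D dualD(2)[OF ft] comult_in_min_tensor)
qed

text \<open>Monomials are group-like for \<Delta>, so convolution becomes multiplication of values
  there.\<close>

lemma convolution_monomial:
  assumes "\<xi> \<in> dual (cstar_red S)" "\<eta> \<in> dual (cstar_red S)" "V \<in> monomials S"
  shows "convolution (cstar_red S) \<Delta> \<xi> \<eta> V = \<xi> V * \<eta> V"
  using functional_tensor_op_tensor[OF cstar_algebra_red cstar_algebra_red assms(1,2)] assms(3)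
  by (simp add: convolution_def monomial_in_red comult_monomial)

lemma banach_algebra_convolution:
  "banach_algebra_of_functions (dual (cstar_red S)) (dual_norm (cstar_red S))
    (convolution (cstar_red S) \<Delta>)"
proof (rule banach_algebra_dual)
  let ?A = "cstar_red S"
  show D: "op_space ?A" by (rule cstar_algebraD(2)[OF cstar_algebra_red])
  note closed = convolution_in_dual dual_add[OF D] dual_scale[OF D]
  fix f g assume f: "f \<in> dual ?A" and g: "g \<in> dual ?A"
  show "convolution ?A \<Delta> f g \<in> dual ?A"
    by (rule convolution_in_dual[OF f g])
  show "dual_norm ?A (convolution ?A \<Delta> f g) \<le> dual_norm ?A f * dual_norm ?A g"
    by (intro dual_norm_le[OF D] convolution_bound f g mult_nonneg_nonneg dual_norm_nonneg D)
  show "convolution ?A \<Delta> (\<lambda>a. c * f a) g = (\<lambda>a. c * convolution ?A \<Delta> f g a)"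
    and "convolution ?A \<Delta> f (\<lambda>a. c * g a) = (\<lambda>a. c * convolution ?A \<Delta> f g a)" for c
    \<comment> \<open>Both sides are bounded functionals, so comparing them on monomials suffices;
      there the claim is an identity for products of complex numbers.\<close>
    by - (rule dual_red_eqI[of _ S]; simp add: closed f g convolution_monomial)+
  fix h assume h: "h \<in> dual ?A"
  show "convolution ?A \<Delta> (convolution ?A \<Delta> f g) h = convolution ?A \<Delta> f (convolution ?A \<Delta> g h)"
    and "convolution ?A \<Delta> (\<lambda>a. f a + g a) h = (\<lambda>a. convolution ?A \<Delta> f h a + convolution ?A \<Delta> g h a)"
    and "convolution ?A \<Delta> h (\<lambda>a. f a + g a) = (\<lambda>a. convolution ?A \<Delta> h f a + convolution ?A \<Delta> h g a)"
    \<comment> \<open>On monomials, associativity and distributivity of convolution are those of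
      complex multiplication.\<close>
    by - (rule dual_red_eqI[of _ S]; simp add: closed f g h convolution_monomial algebra_simps)+
qed

lemma comult_compact_quantum_semigroup: "compact_quantum_semigroup (cstar_red S) \<Delta>"
  unfolding compact_quantum_semigroup_def unital_cstar_algebra_def
  using cstar_algebra_red isom_zero_unit[OF zero_in_S add_in_S] comult_hom comult_inj
    banach_algebra_convolution by blast

end

theorem theorem7:
  fixes S :: "'g::ab_group_add set"
    and \<Delta> :: "('g ell2 \<Rightarrow>\<^sub>L 'g ell2) \<Rightarrow> (('g \<times> 'g) ell2 \<Rightarrow>\<^sub>L ('g \<times> 'g) ell2)"
  assumes torsion_free: "\<And>(n::nat) (x::'g). n > 0 \<Longrightarrow> (\<Sum>i<n. x) = 0 \<Longrightarrow> x = 0"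
    and zero_in_S: "0 \<in> S"
    and add_in_S: "\<And>a b. a \<in> S \<Longrightarrow> b \<in> S \<Longrightarrow> a + b \<in> S"
    and generates: "\<And>g. \<exists>a\<in>S. \<exists>b\<in>S. g = a - b"
    and continuous: "continuous_on (cstar_red S) \<Delta>"
    and on_polynomials: "\<And>(n::nat) (c::nat \<Rightarrow> complex) V. (\<And>i. i < n \<Longrightarrow> V i \<in> monomials S) \<Longrightarrow>
      \<Delta> (\<Sum>i<n. c i *\<^sub>O V i) = (\<Sum>i<n. c i *\<^sub>O op_tensor (V i) (V i))"
  shows "compact_quantum_semigroup (cstar_red S) \<Delta>"
  by (rule comult_compact_quantum_semigroup[OF zero_in_S add_in_S continuous on_polynomials])

end
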